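(* Let $Q,Q_0\in Gr_A$ be such that $\|Q-Q_0\|<r_{Q_0}$. Then there is a unique geodesic $\delta$ (up to reparametrization) of $\mathcal{Q}(\mathcal{H})$ which joins them, and $\delta(t)\in Gr_A$ for all $t\in\mathbb{R}$.
   Context: $\mathcal{H}$ is a Hilbert space, $\mathcal{B}(\mathcal{H})$ is the algebra of bounded operators on $\mathcal{H}$ with the operator norm $\|\cdot\|$, and $A\in\mathcal{B}(\mathcal{H})$ is a positive operator with trivial kernel and $A\le 1$. The compatible Grassmannian is $Gr_A=\{Q\in\mathcal{B}(\mathcal{H}): Q^2=Q,\ Q^*A=AQ\}$. $\mathcal{Q}(\mathcal{H})=\{Q\in\mathcal{B}(\mathcal{H}): Q^2=Q\}$ is the set of all idempotents, a complemented analytic submanifold of $\mathcal{B}(\mathcal{H})$. An operator $X\in\mathcal{B}(\mathcal{H})$ is co-diagonal with respect to $Q\in\mathcal{Q}(\mathcal{H})$ ($Q$-co-diagonal) if $QXQ=(1-Q)X(1-Q)=0$, and $Q$-diagonal if it commutes with $Q$. $\mathcal{Q}(\mathcal{H})$ carries a natural linear connection, induced by the action of the general linear group and the decomposition of $\mathcal{B}(\mathcal{H})$ at every $Q$ into $Q$-diagonal plus $Q$-co-diagonal operators; its geodesics starting at $Q$ are the curves $\delta(t)=e^{tX}Qe^{-tX}$ with $X$ a $Q$-co-diagonal operator. The radius $r_Q$: for each $Q\in\mathcal{Q}(\mathcal{H})$, by the inverse mapping theorem applied to the map $X\mapsto e^XQe^{-X}$ from $Q$-co-diagonal operators to $\mathcal{Q}(\mathcal{H})$,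 a number $r_Q>0$ is fixed such that for every $R\in\mathcal{Q}(\mathcal{H})$ with $\|R-Q\|<r_Q$ there is a unique $Q$-co-diagonal operator $X_R$ with $e^{X_R}Qe^{-X_R}=R$, the map $R\mapsto X_R$ is analytic, and $\|e^{2X_R}-1\|<1$.
   Formalization: Global uniqueness fails for Q_0≠0,1 (nonzero co-diagonal X can give e^X=1), so X_R is unique only in an open neighbourhood V of 0 among co-diagonal operators, and δ is unique among joining geodesics with exponent in V or arc in the r-ball about Q_0. *)

theory Defs
  imports "HOL-Analysis.Analysis"
begin

section \<open>Complex Hilbert spaces\<close>

text \<open>
  The complex inner product is linear in its first argument. Its real part is the inner product
  of \<open>real_inner\<close>, so the norm, the topology and the operator norm of
  \<open>'a \<Rightarrow>\<^sub>L 'a\<close> are the usual ones. The space may have any dimension.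
\<close>

class complex_hilbert = real_inner + complete_space +
  fixes scaleC :: "complex \<Rightarrow> 'a \<Rightarrow> 'a"  (infixr \<open>*\<^sub>C\<close> 75)
    and cinner :: "'a \<Rightarrow> 'a \<Rightarrow> complex"
  assumes scaleC_add_right: "c *\<^sub>C (x + y) = c *\<^sub>C x + c *\<^sub>C y"
    and scaleC_add_left: "(c + d) *\<^sub>C x = c *\<^sub>C x + d *\<^sub>C x"
    and scaleC_scaleC: "c *\<^sub>C d *\<^sub>C x = (c * d) *\<^sub>C x"
    and scaleC_of_real: "complex_of_real s *\<^sub>C x = s *\<^sub>R x"
    and cinner_commute: "cinner x y = cnj (cinner y x)"
    and cinner_add_left: "cinner (x + y) z = cinner x z + cinner y z"
    and cinner_scaleC_left: "cinner (c *\<^sub>C x) y = c * cinner x y"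
    and Re_cinner: "Re (cinner x y) = inner x y"

section \<open>Bounded operators\<close>

text \<open>
  \<open>'a \<Rightarrow>\<^sub>L 'a\<close> consists of the bounded real-linear maps;
  \<open>\<B>(\<H>)\<close> is the closed subalgebra of the complex-linear ones.
\<close>

definition bounded_ops :: "('a::complex_hilbert \<Rightarrow>\<^sub>L 'a) set" where
  "bounded_ops = {T. \<forall>c x. blinfun_apply T (c *\<^sub>C x) = c *\<^sub>C blinfun_apply T x}"

text \<open>For \<open>T \<in> bounded_ops\<close> the adjoint exists and is unique by the Riesz representation theorem.\<close>

definition adj :: "('a::complex_hilbert \<Rightarrow>\<^sub>L 'a) \<Rightarrow> ('a \<Rightarrow>\<^sub>L 'a)" where
  "adj T = (THE S. S \<in> bounded_ops \<and>
     (\<forall>x y. cinner (blinfun_apply T x) y = cinner x (blinfun_apply S y)))"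

definition positive_op :: "('a::complex_hilbert \<Rightarrow>\<^sub>L 'a) \<Rightarrow> bool" where
  "positive_op T \<longleftrightarrow> T \<in> bounded_ops \<and>
     (\<forall>x. cinner (blinfun_apply T x) x \<in> \<real> \<and> 0 \<le> Re (cinner (blinfun_apply T x) x))"

text \<open>
  \<open>'a \<Rightarrow>\<^sub>L 'a\<close> is not an instance of the type class required by the library's
  \<^const>\<open>exp\<close>, so the exponential series is written out.
\<close>

definition op_power :: "('a::real_normed_vector \<Rightarrow>\<^sub>L 'a) \<Rightarrow> nat \<Rightarrow> ('a \<Rightarrow>\<^sub>L 'a)" where
  "op_power X n = ((\<lambda>Y. X o\<^sub>L Y) ^^ n) id_blinfun"

definition op_exp :: "('a::real_normed_vector \<Rightarrow>\<^sub>L 'a) \<Rightarrow> ('a \<Rightarrow>\<^sub>L 'a)" where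
  "op_exp X = (\<Sum>n. (1 / fact n) *\<^sub>R op_power X n)"

definition exp_conj :: "('a::real_normed_vector \<Rightarrow>\<^sub>L 'a) \<Rightarrow> ('a \<Rightarrow>\<^sub>L 'a) \<Rightarrow> ('a \<Rightarrow>\<^sub>L 'a)" where
  "exp_conj X Q = op_exp X o\<^sub>L Q o\<^sub>L op_exp (- X)"

section \<open>Idempotents, the compatible Grassmannian, geodesics\<close>

definition idempotents :: "('a::complex_hilbert \<Rightarrow>\<^sub>L 'a) set" where
  "idempotents = {Q \<in> bounded_ops. Q o\<^sub>L Q = Q}"

definition compatible_Gr ::
    "('a::complex_hilbert \<Rightarrow>\<^sub>L 'a) \<Rightarrow> ('a \<Rightarrow>\<^sub>L 'a) set" where
  "compatible_Gr A = {Q \<in> bounded_ops. Q o\<^sub>L Q = Q \<and> adj Q o\<^sub>L A = A o\<^sub>L Q}"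

definition codiagonal ::
    "('a::complex_hilbert \<Rightarrow>\<^sub>L 'a) \<Rightarrow> ('a \<Rightarrow>\<^sub>L 'a) set" where
  "codiagonal Q = {X \<in> bounded_ops. Q o\<^sub>L X o\<^sub>L Q = 0 \<and>
     (id_blinfun - Q) o\<^sub>L X o\<^sub>L (id_blinfun - Q) = 0}"

definition geodesic :: "(real \<Rightarrow> ('a::complex_hilbert \<Rightarrow>\<^sub>L 'a)) \<Rightarrow> bool" where
  "geodesic \<gamma> \<longleftrightarrow> (\<exists>P\<in>idempotents. \<exists>X\<in>codiagonal P. \<forall>t. \<gamma> t = exp_conj (t *\<^sub>R X) P)"

definition joins ::
    "(real \<Rightarrow> 'b) \<Rightarrow> real \<Rightarrow> real \<Rightarrow> 'b \<Rightarrow> 'b \<Rightarrow> bool" where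
  "joins \<gamma> a b P R \<longleftrightarrow> a \<noteq> b \<and> \<gamma> a = P \<and> \<gamma> b = R"

section \<open>Analytic maps\<close>

text \<open>
  An \<open>n\<close>-linear map takes its arguments as a sequence, of which only the first
  \<open>n\<close> entries matter.
\<close>

definition bounded_n_linear ::
    "nat \<Rightarrow> real \<Rightarrow> ((nat \<Rightarrow> 'a::real_normed_vector) \<Rightarrow> 'b::real_normed_vector) \<Rightarrow> bool" where
  "bounded_n_linear n B m \<longleftrightarrow>
     (\<forall>v w. (\<forall>i<n. v i = w i) \<longrightarrow> m v = m w) \<and>
     (\<forall>i<n. \<forall>v. linear (\<lambda>x. m (v(i := x)))) \<and>
     (\<forall>v. norm (m v) \<le> B * (\<Prod>i<n. norm (v i)))"

text \<open>
  Analyticity between Banach spaces is taken over the real scalars, as it occurs only as a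
  hypothesis and complex analytic maps are real analytic.
\<close>

definition analytic_map_at ::
    "('a::real_normed_vector \<Rightarrow> 'b::real_normed_vector) \<Rightarrow> 'a \<Rightarrow> bool" where
  "analytic_map_at f x \<longleftrightarrow> (\<exists>\<rho> C K a. \<rho> > 0 \<and> C \<ge> 0 \<and> K \<ge> 0 \<and>
     (\<forall>n. bounded_n_linear n (C * K ^ n) (a n)) \<and>
     (\<forall>h. norm h < \<rho> \<longrightarrow> (\<lambda>n. a n (\<lambda>_. h)) sums f (x + h)))"

text \<open>
  A map on an open part \<open>S\<close> of a complemented analytic submanifold is analytic
  iff it locally extends to an analytic map on the ambient Banach space.
\<close>

definition analytic_map_on ::
    "'a::real_normed_vector set \<Rightarrow> ('a \<Rightarrow> 'b::real_normed_vector) \<Rightarrow> bool" where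
  "analytic_map_on S f \<longleftrightarrow> (\<forall>x\<in>S. \<exists>g. analytic_map_at g x \<and>
     (\<exists>e>0. \<forall>y\<in>S. dist y x < e \<longrightarrow> f y = g y))"

section \<open>The radius\<close>

text \<open>
  The inverse mapping theorem inverts \<open>X \<mapsto> e\<^sup>X Q e\<^bsup>-X\<^esup>\<close> only near
  \<open>0\<close>, so the uniqueness of \<open>X\<^sub>R\<close> is uniqueness in a neighbourhood
  \<open>V\<close> of \<open>0\<close> among the \<open>Q\<close>-co-diagonal operators.
  Among all co-diagonal operators it fails whenever \<open>Q\<close> is neither \<open>0\<close> nor
  \<open>1\<close>: there are nonzero co-diagonal \<open>X\<close> with \<open>e\<^sup>X = 1\<close>.
\<close>

definition inverse_radius ::
    "('a::complex_hilbert \<Rightarrow>\<^sub>L 'a) \<Rightarrow> real \<Rightarrow> ('a \<Rightarrow>\<^sub>L 'a) set \<Rightarrow> bool" where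
  "inverse_radius Q r V \<longleftrightarrow> r > 0 \<and>
     openin (top_of_set (codiagonal Q)) V \<and> 0 \<in> V \<and>
     (\<exists>\<xi>. (\<forall>R\<in>idempotents. norm (R - Q) < r \<longrightarrow>
            (\<exists>!X. X \<in> V \<and> exp_conj X Q = R) \<and>
            \<xi> R \<in> V \<and> exp_conj (\<xi> R) Q = R \<and>
            norm (op_exp (2 *\<^sub>R \<xi> R) - id_blinfun) < 1) \<and>
          analytic_map_on {R \<in> idempotents. norm (R - Q) < r} \<xi>)"

text \<open>
  Correspondingly, geodesics joining two nearby points are unique only as short geodesics
  (on a Grassmannian one may wind around closed geodesics). The next two predicates
  express that the arc of \<open>\<gamma>\<close> from parameter \<open>a\<close> to
  \<open>b\<close> is short: rescaled to the parameter interval \<open>[0, 1]\<close> it has its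
  exponent in \<open>V\<close>, respectively it remains in the open ball of radius
  \<open>r\<close> about its starting point.
\<close>

definition exponent_in ::
    "('a::complex_hilbert \<Rightarrow>\<^sub>L 'a) set \<Rightarrow> (real \<Rightarrow> ('a \<Rightarrow>\<^sub>L 'a)) \<Rightarrow> real \<Rightarrow> real \<Rightarrow> bool" where
  "exponent_in V \<gamma> a b \<longleftrightarrow> (\<exists>X\<in>codiagonal (\<gamma> a).
     (\<forall>t. \<gamma> t = exp_conj ((t - a) *\<^sub>R X) (\<gamma> a)) \<and> (b - a) *\<^sub>R X \<in> V)"

definition arc_in_ball ::
    "real \<Rightarrow> (real \<Rightarrow> 'b::real_normed_vector) \<Rightarrow> real \<Rightarrow> real \<Rightarrow> bool" where
  "arc_in_ball r \<gamma> a b \<longleftrightarrow> (\<forall>t\<in>closed_segment a b. norm (\<gamma> t - \<gamma> a) < r)"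

definition reparametrization_of :: "(real \<Rightarrow> 'b) \<Rightarrow> (real \<Rightarrow> 'b) \<Rightarrow> bool" where
  "reparametrization_of \<gamma> \<delta> \<longleftrightarrow> (\<exists>c d. c \<noteq> 0 \<and> (\<forall>t. \<gamma> t = \<delta> (c * t + d)))"

end

theory Submission
  imports Defs
begin

text \<open>
  Write \<open>s = 2 Q\<^sub>0 - 1\<close>, a symmetry. An operator \<open>X\<close> is
  \<open>Q\<^sub>0\<close>-co-diagonal iff it anticommutes with \<open>s\<close>, and then
  \<open>e\<^sup>X s e\<^bsup>-X\<^esup> = e\<^bsup>2X\<^esup> s\<close>. Hence a geodesic from
  \<open>Q\<^sub>0\<close> to \<open>Q\<close> is the same as a co-diagonal \<open>X\<close> with
  \<open>e\<^bsup>2X\<^esup> = (2 Q - 1) s\<close>. The radius guarantees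
  \<open>\<parallel>(2 Q - 1) s - 1\<parallel> < 1\<close>, so the power series of the logarithm yields a
  distinguished solution \<open>X = \<onehalf> ln ((2 Q - 1) s)\<close>. Everything that is claimed about
  the geodesic is read off from this formula.

  \<^item> It is co-diagonal: conjugation with \<open>s\<close> inverts \<open>(2 Q - 1) s\<close>, so it
    changes the sign of the logarithm (\<open>ln1p_inverse_conjugate\<close>).

  \<^item> It is short: with \<open>y = (2 Q - 1) s - 1\<close> the displacement
    \<open>\<delta>(t) - Q\<^sub>0\<close> is \<open>\<onehalf> ((1 + y)\<^sup>t - 1) s\<close>, and
    \<open>norm_exp_ln1p_minus_one_le\<close> shows that for \<open>t \<in> [0, 1]\<close> it is no
    longer than \<open>\<onehalf> y s = Q - Q\<^sub>0\<close>. So the arc stays in the ball of radius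
    \<open>r\<close>.

  \<^item> It stays in the compatible Grassmannian: for the form \<open>\<langle>u, A v\<rangle>\<close> the
    symmetries \<open>s\<close> and \<open>2 Q - 1\<close> are self-adjoint, hence the adjoint of
    \<open>(2 Q - 1) s\<close> is \<open>s (2 Q - 1)\<close>, its conjugate by \<open>s\<close>. Comparing
    power series, the adjoint of \<open>X\<close> is \<open>s X s = - X\<close>
    (\<open>short_geodesic_exponent\<close>), so \<open>e\<^bsup>tX\<^esup>\<close> is unitary for the form and
    conjugation with it keeps \<open>Q\<^sub>0\<close> self-adjoint.

  Uniqueness is a lifting argument (\<open>arc_in_ball_exponent_mem\<close>). If the geodesic with
  exponent \<open>Z\<close> stays in the ball, the set of all \<open>t \<in> [0, 1]\<close> with
  \<open>t Z \<in> V\<close> is open because \<open>V\<close> is, and closed because it is where the continuous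
  curves \<open>\<xi>(e\<^bsup>tZ\<^esup> Q\<^sub>0 e\<^bsup>-tZ\<^esup>)\<close> and
  \<open>t Z\<close> agree; it contains \<open>0\<close>, so it contains \<open>1\<close>. This applies to the
  logarithm, which therefore lies in \<open>V\<close>, and to every competing geodesic, whose exponent is
  then the one element of \<open>V\<close> that represents \<open>Q\<close>.
\<close>

section \<open>The logarithm in a Banach algebra\<close>

subsection \<open>The exponential along a commuting curve\<close>

lemma norm_exp_first_order_remainder:
  fixes h :: "'b::{real_normed_algebra_1,banach}"
  assumes "norm h \<le> 1"
  shows "norm (exp h - 1 - h) \<le> (norm h)\<^sup>2"
proof -
  have sh: "(\<lambda>n. h ^ (n + 2) /\<^sub>R fact (n + 2)) sums (exp h - 1 - h)"
    using sums_split_initial_segment[OF exp_converges[of h], of 2]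
    by (simp add: numeral_2_eq_2 diff_diff_eq)
  have sn: "(\<lambda>n. norm h ^ (n + 2) /\<^sub>R fact (n + 2)) sums (exp (norm h) - 1 - norm h)"
    using sums_split_initial_segment[OF exp_converges[of "norm h"], of 2]
    by (simp add: numeral_2_eq_2 diff_diff_eq)
  have "norm (exp h - 1 - h) \<le> exp (norm h) - 1 - norm h"
  proof -
    have "norm (h ^ (n + 2) /\<^sub>R fact (n + 2)) \<le> norm h ^ (n + 2) /\<^sub>R fact (n + 2)" for n
      unfolding norm_scaleR real_scaleR_def
      by (rule mult_mono) (auto simp: norm_power_ineq simp del: power_Suc add_2_eq_Suc')
    then show ?thesis
      using norm_suminf_le[OF _ sums_summable[OF sn], of "\<lambda>n. h ^ (n + 2) /\<^sub>R fact (n + 2)"]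
        sums_unique[OF sh] sums_unique[OF sn] by metis
  qed
  also have "\<dots> \<le> (norm h)\<^sup>2"
    using exp_bound[of "norm h"] assms by simp
  finally show ?thesis .
qed

lemma has_derivative_exp_zero:
  "((exp :: 'b \<Rightarrow> 'b::{real_normed_algebra_1,banach}) has_derivative (\<lambda>h. h)) (at 0)"
proof (rule has_derivativeI_sandwich[of 1])
  show "norm (exp y - exp 0 - (y - 0)) / norm (y - 0) \<le> norm y"
    if "y \<noteq> 0" "dist y 0 < 1" for y :: 'b
    using norm_exp_first_order_remainder[of y] that
    by (simp add: divide_le_eq power2_eq_square)
  show "((\<lambda>y::'b. norm y) \<longlongrightarrow> 0) (at 0)"
    by (intro tendsto_eq_intros) auto
qed auto

text \<open>
  Commutativity lets \<open>exp (f s)\<close> be split off, which reduces the claim to the derivative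
  of \<^const>\<open>exp\<close> at \<open>0\<close>.
\<close>
lemma exp_has_vector_derivative_commuting:
  fixes f :: "real \<Rightarrow> 'b::{real_normed_algebra_1,banach}"
  assumes f: "(f has_vector_derivative d) (at s within S)"
    and comm: "\<And>u. u \<in> S \<Longrightarrow> f u * f s = f s * f u" and s: "s \<in> S"
  shows "((\<lambda>u. exp (f u)) has_vector_derivative exp (f s) * d) (at s within S)"
proof -
  have "((\<lambda>u. f u - f s) has_derivative (\<lambda>h. h *\<^sub>R d)) (at s within S)"
    using f unfolding has_vector_derivative_def by (auto intro!: derivative_eq_intros)
  then have "((\<lambda>u. exp (f u - f s)) has_derivative (\<lambda>h. h *\<^sub>R d)) (at s within S)"
    by (rule has_derivative_compose[where g = exp]) (simp add: has_derivative_exp_zero)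
  then have "((\<lambda>u. exp (f s) * exp (f u - f s)) has_derivative (\<lambda>h. exp (f s) * (h *\<^sub>R d)))
      (at s within S)"
    by (rule bounded_linear.has_derivative[OF bounded_linear_mult_right])
  then have "((\<lambda>u. exp (f u)) has_derivative (\<lambda>h. exp (f s) * (h *\<^sub>R d))) (at s within S)"
  proof (rule has_derivative_transform[rotated 2])
    fix u assume "u \<in> S"
    then have "f s * (f u - f s) = (f u - f s) * f s"
      using comm by (simp add: algebra_simps)
    from exp_add_commuting[OF this] show "exp (f u) = exp (f s) * exp (f u - f s)"
      by simp
  qed (use s in auto)
  then show ?thesis
    by (simp add: has_vector_derivative_def)
qed

lemma exp_minus_inverse':
  fixes x :: "'b::{real_normed_algebra_1,banach}"
  shows "exp (- x) * exp x = 1"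
  using exp_minus_inverse[of "- x"] by simp

text \<open>
  Intertwining relations and adjoints of exponentials are both instances of two continuous linear
  maps that agree on corresponding powers. The same pattern recurs below for the logarithm.
\<close>
lemma exp_transfer:
  fixes x x' :: "'b::{real_normed_algebra_1,banach}"
  assumes f: "bounded_linear f" and g: "bounded_linear g" and fg: "\<And>n. f (x ^ n) = g (x' ^ n)"
  shows "f (exp x) = g (exp x')"
proof -
  have "(\<lambda>n. f (x ^ n /\<^sub>R fact n)) sums f (exp x)" "(\<lambda>n. g (x' ^ n /\<^sub>R fact n)) sums g (exp x')"
    by (intro bounded_linear.sums[OF f] bounded_linear.sums[OF g] exp_converges)+
  then show ?thesis
    by (simp add: linear_cmul[OF bounded_linear.linear[OF f]] linear_cmul[OF bounded_linear.linear[OF g]] fg sums_unique2)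
qed

lemma exp_intertwines:
  fixes x x' u :: "'b::{real_normed_algebra_1,banach}"
  assumes "u * x = x' * u"
  shows "u * exp x = exp x' * u"
proof (rule exp_transfer)
  show "u * x ^ n = x' ^ n * u" for n
  proof (induction n)
    case (Suc n)
    have "u * x ^ Suc n = (u * x) * x ^ n" by (simp add: mult.assoc)
    also have "\<dots> = x' * (u * x ^ n)" by (simp add: assms mult.assoc)
    finally show ?case by (simp add: Suc mult.assoc)
  qed simp
qed (auto intro: bounded_linear_mult_left bounded_linear_mult_right)

subsection \<open>The power series of the logarithm and its derivative\<close>

definition ln1p :: "'b::{real_normed_algebra_1,banach} \<Rightarrow> 'b" where
  "ln1p y = (\<Sum>n. ((-1) ^ n / real (Suc n)) *\<^sub>R y ^ Suc n)"

lemma norm_ln1p_term_le: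
  fixes y :: "'b::{real_normed_algebra_1,banach}"
  shows "norm (((-1) ^ n / real (Suc n)) *\<^sub>R y ^ Suc n) \<le> norm y ^ Suc n / real (Suc n)"
  using norm_power_ineq[of y "Suc n"] by (simp add: divide_right_mono del: power_Suc)

lemma ln_one_minus_sums:
  assumes "0 \<le> v" "v < (1::real)"
  shows "(\<lambda>n. v ^ Suc n / real (Suc n)) sums (- ln (1 - v))"
proof -
    have "(\<lambda>n. - ((- (- v)) ^ n) / real n) sums ln (1 + - v)"
      by (rule ln_series') (use assms in auto)
    then have "(\<lambda>n. - (v ^ Suc n / real (Suc n))) sums ln (1 - v)"
      by (subst sums_Suc_iff) simp
    then have "(\<lambda>n. - (- (v ^ Suc n / real (Suc n)))) sums (- ln (1 - v))"
      by (rule sums_minus)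
  then show ?thesis by (simp del: power_Suc)
qed

lemma ln1p_sums:
  fixes y :: "'b::{real_normed_algebra_1,banach}"
  assumes "norm y < 1"
  shows "(\<lambda>n. ((-1) ^ n / real (Suc n)) *\<^sub>R y ^ Suc n) sums ln1p y"
  unfolding ln1p_def
  by (rule summable_sums, rule summable_comparison_test'[OF sums_summable[OF ln_one_minus_sums[of "norm y"]]])
     (use assms norm_ln1p_term_le in auto)

lemma norm_ln1p_le:
  fixes y :: "'b::{real_normed_algebra_1,banach}"
  assumes "norm y < 1"
  shows "norm (ln1p y) \<le> - ln (1 - norm y)"
  using norm_suminf_le[OF norm_ln1p_term_le sums_summable[OF ln_one_minus_sums[of "norm y"]]]
    sums_unique[OF ln_one_minus_sums[of "norm y"]] assms by (simp add: ln1p_def)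

lemma ln1p_transfer:
  fixes y :: "'b::{real_normed_algebra_1,banach}"
  assumes y: "norm y < 1" and f: "bounded_linear f" and g: "bounded_linear g"
    and fg: "\<And>n. f (y ^ Suc n) = g (y ^ Suc n)"
  shows "f (ln1p y) = g (ln1p y)"
proof -
  have "(\<lambda>n. f (((-1) ^ n / real (Suc n)) *\<^sub>R y ^ Suc n)) sums f (ln1p y)"
    "(\<lambda>n. g (((-1) ^ n / real (Suc n)) *\<^sub>R y ^ Suc n)) sums g (ln1p y)"
    by (intro bounded_linear.sums[OF f] bounded_linear.sums[OF g] ln1p_sums y)+
  then show ?thesis
    by (simp only: linear_cmul[OF bounded_linear.linear[OF f]]
        linear_cmul[OF bounded_linear.linear[OF g]] fg sums_unique2)
qed

lemma ln1p_commutes: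
  fixes y z :: "'b::{real_normed_algebra_1,banach}"
  assumes y: "norm y < 1" and c: "z * y = y * z"
  shows "z * ln1p y = ln1p y * z"
proof (rule ln1p_transfer[OF y])
  show "z * y ^ Suc n = y ^ Suc n * z" for n
    using power_commuting_commutes[OF c[symmetric], of "Suc n"] by simp
qed (auto intro: bounded_linear_mult_left bounded_linear_mult_right)

lemma ln1p_zero [simp]: "ln1p 0 = 0"
  by (simp add: ln1p_def)

text \<open>The Neumann series: the inverse of \<open>1 + y\<close> if \<open>\<parallel>y\<parallel> < 1\<close>.\<close>
definition neumann :: "'b::{real_normed_algebra_1,banach} \<Rightarrow> 'b" where
  "neumann y = (\<Sum>n. (- y) ^ n)"

lemma neumann:
  fixes y :: "'b::{real_normed_algebra_1,banach}"
  assumes "norm y < 1"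
  shows "neumann y * (1 + y) = 1" "(1 + y) * neumann y = 1"
proof -
  have summ: "summable (\<lambda>n. (- y) ^ n)"
    using assms by (simp add: complete_algebra_summable_geometric)
  have split: "neumann y = 1 + (\<Sum>n. (- y) ^ Suc n)"
    using suminf_split_head[OF summ] unfolding neumann_def by (simp del: power_Suc)
  have "(\<Sum>n. (- y) ^ Suc n) = - y * neumann y"
    unfolding neumann_def power_Suc by (rule suminf_mult[OF summ])
  moreover have "(\<Sum>n. (- y) ^ Suc n) = neumann y * - y"
    unfolding neumann_def power_Suc2 by (rule suminf_mult2[OF summ, symmetric])
  ultimately have "neumann y = 1 - y * neumann y"  "neumann y = 1 - neumann y * y"
    using split by simp_all
  then show "(1 + y) * neumann y = 1" "neumann y * (1 + y) = 1"
    by (simp_all add: algebra_simps)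
qed

text \<open>
  Along the ray \<open>s \<mapsto> s y\<close> everything commutes, so that
  \<open>ln (1 + s y)\<close> has the derivative \<open>y (1 + s y)\<^sup>-\<^sup>1\<close> known from
  the scalar case. All identities and estimates for the logarithm below are obtained by
  differentiating in \<open>s\<close>.
\<close>
lemma ln1p_has_vector_derivative:
  fixes y :: "'b::{real_normed_algebra_1,banach}"
  assumes y: "norm y < 1" and s: "s \<in> {0..1}"
  shows "((\<lambda>s. ln1p (s *\<^sub>R y)) has_vector_derivative y * neumann (s *\<^sub>R y)) (at s within {0..1})"
proof -
  have le: "norm (s *\<^sub>R y) \<le> norm y" if "s \<in> {0..1}" for s
    using that by (simp add: mult_left_le_one_le)
  let ?f = "\<lambda>n s. ((-1) ^ n / real (Suc n)) *\<^sub>R (s *\<^sub>R y) ^ Suc n"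
  have unif: "uniform_limit {0..1} (\<lambda>n s. \<Sum>i<n. (- (s *\<^sub>R y)) ^ i) (\<lambda>s. \<Sum>i. (- (s *\<^sub>R y)) ^ i) sequentially"
  proof (rule Weierstrass_m_test)
    show "norm ((- (s *\<^sub>R y)) ^ n) \<le> norm y ^ n" if "s \<in> {0..1}" for n s
      using norm_power_ineq[of "- (s *\<^sub>R y)" n] power_mono[OF le[OF that], of n] by simp
  qed (use y in simp)
  have "\<exists>g. \<forall>x\<in>{0..1}. (\<lambda>n. ?f n x) sums g x \<and>
      (g has_derivative (\<lambda>h. h *\<^sub>R (y * neumann (x *\<^sub>R y)))) (at x within {0..1})"
  proof (rule has_derivative_series[where f' = "\<lambda>n s h. h *\<^sub>R (y * (- (s *\<^sub>R y)) ^ n)"])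
    show "(?f n has_derivative (\<lambda>h. h *\<^sub>R (y * (- (x *\<^sub>R y)) ^ n))) (at x within {0..1})" for n x
    proof -
      have "((\<lambda>s. (((-1) ^ n / real (Suc n)) * s ^ Suc n) *\<^sub>R y ^ Suc n) has_derivative
          (\<lambda>h. (h * ((-1) ^ n * x ^ n)) *\<^sub>R y ^ Suc n)) (at x within {0..1})"
        by (rule derivative_eq_intros refl)+ (auto simp: field_simps)
      moreover have "y * (- (x *\<^sub>R y)) ^ n = ((-1) ^ n * x ^ n) *\<^sub>R y ^ Suc n"
        by (simp only: scaleR_minus_left[symmetric] scaleR_power power_minus[of x] mult_scaleR_right power_Suc)
      ultimately show ?thesis
        by (simp only: scaleR_power scaleR_scaleR mult.assoc)
    qed
    show "\<forall>\<^sub>F n in sequentially. \<forall>x\<in>{0..1}. \<forall>h. norm ((\<Sum>i<n. h *\<^sub>R (y * (- (x *\<^sub>R y)) ^ i))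
        - h *\<^sub>R (y * neumann (x *\<^sub>R y))) \<le> e * norm h" if "e > 0" for e
    proof -
      have "\<forall>\<^sub>F n in sequentially. \<forall>x\<in>{0..1}. dist (\<Sum>i<n. (- (x *\<^sub>R y)) ^ i) (neumann (x *\<^sub>R y)) < e"
        using unif that by (simp add: uniform_limit_iff neumann_def)
      then show ?thesis
      proof eventually_elim
        case (elim n)
        show ?case
        proof (intro ballI allI)
          fix x h :: real assume x: "x \<in> {0..1}"
          let ?d = "(\<Sum>i<n. (- (x *\<^sub>R y)) ^ i) - neumann (x *\<^sub>R y)"
          have "(\<Sum>i<n. h *\<^sub>R (y * (- (x *\<^sub>R y)) ^ i)) - h *\<^sub>R (y * neumann (x *\<^sub>R y)) = h *\<^sub>R (y * ?d)"
            by (simp add: scaleR_sum_right sum_distrib_left scaleR_right_diff_distrib right_diff_distrib)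
          moreover have "norm (y * ?d) \<le> e"
          proof -
            have "norm (y * ?d) \<le> norm y * norm ?d" by (rule norm_mult_ineq)
            also have "\<dots> \<le> 1 * e"
              using elim x y by (intro mult_mono) (auto simp: dist_norm less_imp_le)
            finally show ?thesis by simp
          qed
          ultimately show "norm ((\<Sum>i<n. h *\<^sub>R (y * (- (x *\<^sub>R y)) ^ i)) - h *\<^sub>R (y * neumann (x *\<^sub>R y)))
              \<le> e * norm h"
            by (simp add: mult.commute[of e] mult_left_mono)
        qed
      qed
    qed
    show "(\<lambda>n. ?f n 0) sums 0" by simp
  qed auto
  then obtain g where g: "\<And>x. x \<in> {0..1} \<Longrightarrow> (\<lambda>n. ?f n x) sums g x"
    "\<And>x. x \<in> {0..1} \<Longrightarrow> (g has_derivative (\<lambda>h. h *\<^sub>R (y * neumann (x *\<^sub>R y)))) (at x within {0..1})"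
    by blast
  have "g x = ln1p (x *\<^sub>R y)" if "x \<in> {0..1}" for x
    using sums_unique2[OF g(1)[OF that] ln1p_sums] le[OF that] y by simp
  then show ?thesis
    unfolding has_vector_derivative_def
    using has_derivative_transform[OF s, of "\<lambda>s. ln1p (s *\<^sub>R y)" g] g(2)[OF s] by simp
qed

subsection \<open>Exponential, growth and inversion of the logarithm\<close>

context
  fixes y :: "'b::{real_normed_algebra_1,banach}"
  assumes y: "norm y < 1"
begin

lemma norm_scaled_lt: "s \<in> {0..1} \<Longrightarrow> norm (s *\<^sub>R y) < 1"
  using y mult_left_le_one_le[of "norm y" s] by simp

lemma ln1p_scaled_commutes:
  assumes "s \<in> {0..1}" "z * y = y * z"
  shows "z * ln1p (s *\<^sub>R y) = ln1p (s *\<^sub>R y) * z"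
  using assms by (intro ln1p_commutes norm_scaled_lt) auto

lemma exp_ln1p_has_vector_derivative:
  assumes s: "s \<in> {0..1}"
  shows "((\<lambda>s. exp (t *\<^sub>R ln1p (s *\<^sub>R y))) has_vector_derivative
     exp (t *\<^sub>R ln1p (s *\<^sub>R y)) * (t *\<^sub>R (y * neumann (s *\<^sub>R y)))) (at s within {0..1})"
proof (rule exp_has_vector_derivative_commuting[OF _ _ s])
  show "((\<lambda>s. t *\<^sub>R ln1p (s *\<^sub>R y)) has_vector_derivative t *\<^sub>R (y * neumann (s *\<^sub>R y))) (at s within {0..1})"
    by (rule bounded_linear.has_vector_derivative[OF bounded_linear_scaleR_right])
      (rule ln1p_has_vector_derivative[OF y s])
  show "t *\<^sub>R ln1p (u *\<^sub>R y) * t *\<^sub>R ln1p (s *\<^sub>R y) = t *\<^sub>R ln1p (s *\<^sub>R y) * t *\<^sub>R ln1p (u *\<^sub>R y)"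
    if "u \<in> {0..1}" for u
    using ln1p_scaled_commutes[OF s, of "ln1p (u *\<^sub>R y)"] ln1p_scaled_commutes[OF that, of y] by simp
qed

lemma exp_ln1p_scaled:
  assumes s: "s \<in> {0..1}"
  shows "exp (ln1p (s *\<^sub>R y)) = 1 + s *\<^sub>R y"
proof -
  let ?g = "\<lambda>s. exp (- ln1p (s *\<^sub>R y)) * (1 + s *\<^sub>R y)"
  have "(?g has_vector_derivative 0) (at u within {0..1})" if u: "u \<in> {0..1}" for u
  proof -
    have "((\<lambda>s. 1 + s *\<^sub>R y) has_vector_derivative y) (at u within {0..1})"
      by (auto intro!: derivative_eq_intros)
    from has_vector_derivative_mult[OF exp_ln1p_has_vector_derivative[OF u, of "-1"] this]
    have "(?g has_vector_derivative exp (- ln1p (u *\<^sub>R y)) * y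
        + exp (- ln1p (u *\<^sub>R y)) * (- (y * neumann (u *\<^sub>R y))) * (1 + u *\<^sub>R y)) (at u within {0..1})"
      by simp
    moreover have "exp (- ln1p (u *\<^sub>R y)) * (- (y * neumann (u *\<^sub>R y))) * (1 + u *\<^sub>R y)
       = - (exp (- ln1p (u *\<^sub>R y)) * y * (neumann (u *\<^sub>R y) * (1 + u *\<^sub>R y)))"
      by (simp only: mult.assoc mult_minus_left mult_minus_right)
    ultimately show ?thesis
      using neumann(1)[OF norm_scaled_lt[OF u]] by simp
  qed
  then obtain c where "\<And>u. u \<in> {0..1} \<Longrightarrow> ?g u = c"
    using has_vector_derivative_zero_constant[of "{0..1}" ?g] convex_real_interval(5) by blast
  then have "?g s = ?g 0"
    using s by (metis atLeastAtMost_iff order_refl zero_le_one)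
  then have "exp (- ln1p (s *\<^sub>R y)) * (1 + s *\<^sub>R y) = 1" by simp
  then have "exp (ln1p (s *\<^sub>R y)) * exp (- ln1p (s *\<^sub>R y)) * (1 + s *\<^sub>R y) = exp (ln1p (s *\<^sub>R y))"
    by (simp add: mult.assoc)
  then show ?thesis by (simp add: exp_minus_inverse)
qed

lemma exp_ln1p: "exp (ln1p y) = 1 + y"
  using exp_ln1p_scaled[of 1] by simp

text \<open>
  The curve \<open>s \<mapsto> (1 + s y)\<^sup>t z\<close> has the derivative
  \<open>t (1 + s y)\<^bsup>t-1\<^esup> y z\<close>. Its norm is at most
  \<open>t (1 - s v)\<^bsup>t-1\<^esup> \<parallel>y z\<parallel>\<close> with \<open>v = \<parallel>y\<parallel>\<close>,
  and this bound integrates over \<open>[0, 1]\<close> to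
  \<open>\<parallel>y z\<parallel> (1 - (1 - v)\<^sup>t) / v \<le> \<parallel>y z\<parallel>\<close>. The factor \<open>z\<close>
  is kept because an estimate by \<open>\<parallel>y\<parallel> \<parallel>z\<parallel>\<close> would be too weak to keep
  the geodesic inside the ball.
\<close>
lemma norm_exp_ln1p_minus_one_le:
  assumes t: "t \<in> {0..1}"
  shows "norm ((exp (t *\<^sub>R ln1p y) - 1) * z) \<le> norm (y * z)"
proof (cases "y = 0")
  case False
  define v where "v = norm y"
  have v: "0 < v" "v < 1" using False y by (auto simp: v_def)
  define c where "c = norm (y * z)"
  let ?f = "\<lambda>s. exp (t *\<^sub>R ln1p (s *\<^sub>R y)) * z"
  \<comment> \<open>An antiderivative of the bound \<open>c t (1 - s v)\<^bsup>t-1\<^esup>\<close> for the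
    derivative of \<open>?f\<close>.\<close>
  let ?p = "\<lambda>s. - (c / v) * (1 - s * v) powr t"
  have sv: "0 < 1 - s * v" if "s \<in> {0..1}" for s
    using norm_scaled_lt[OF that] that by (simp add: v_def)
  have df: "(?f has_vector_derivative exp (t *\<^sub>R ln1p (s *\<^sub>R y)) * (t *\<^sub>R (y * neumann (s *\<^sub>R y))) * z)
      (at s within {0..1})" if "s \<in> {0..1}" for s
    by (rule bounded_linear.has_vector_derivative[OF bounded_linear_mult_left])
      (rule exp_ln1p_has_vector_derivative[OF that])
  have dp: "(?p has_real_derivative c * t * (1 - s * v) powr (t - 1)) (at s)" if "s \<in> {0..1}" for s
    using sv[OF that] v by (auto intro!: derivative_eq_intros simp: field_simps powr_diff)
  have "norm (?f 1 - ?f 0) \<le> ?p 1 - ?p 0"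
  proof (rule differentiable_bound_general)
    show "continuous_on {0..1} ?f"
      using df by (meson continuous_on_eq_continuous_within has_vector_derivative_continuous)
    show "continuous_on {0..1} ?p"
      using dp by (meson DERIV_isCont continuous_at_imp_continuous_on)
    fix s :: real assume s: "0 < s" "s < 1"
    then have s': "s \<in> {0..1}" by simp
    show "(?f has_vector_derivative exp (t *\<^sub>R ln1p (s *\<^sub>R y)) * (t *\<^sub>R (y * neumann (s *\<^sub>R y))) * z) (at s)"
      using df[OF s'] s at_within_interior[of s "{0..1}"] by simp
    show "(?p has_vector_derivative c * t * (1 - s * v) powr (t - 1)) (at s)"
      using dp[OF s'] by (simp add: has_real_derivative_iff_has_vector_derivative)
    let ?l = "ln1p (s *\<^sub>R y)"
    have N: "neumann (s *\<^sub>R y) = exp (- ?l)"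
    proof -
      have "neumann (s *\<^sub>R y) = neumann (s *\<^sub>R y) * ((1 + s *\<^sub>R y) * exp (- ?l))"
        using exp_minus_inverse[of ?l] by (simp add: exp_ln1p_scaled[OF s'])
      then show ?thesis
        using neumann(1)[OF norm_scaled_lt[OF s']] by (simp add: mult.assoc[symmetric])
    qed
    have c1: "y * exp (- ?l) = exp (- ?l) * y"
      by (rule exp_intertwines) (use ln1p_scaled_commutes[OF s', of y] in simp)
    have "exp (t *\<^sub>R ?l) * exp (- ?l) = exp ((t - 1) *\<^sub>R ?l)"
      by (subst exp_add_commuting[symmetric]) (auto simp: algebra_simps)
    then have "exp (t *\<^sub>R ?l) * (t *\<^sub>R (y * neumann (s *\<^sub>R y))) * z = t *\<^sub>R (exp ((t - 1) *\<^sub>R ?l) * (y * z))"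
      by (simp add: N c1 mult.assoc[symmetric])
    also have "norm \<dots> \<le> t * (norm (exp ((t - 1) *\<^sub>R ?l)) * c)"
      using t norm_mult_ineq[of "exp ((t - 1) *\<^sub>R ?l)" "y * z"] by (simp add: c_def mult_left_mono)
    also have "\<dots> \<le> t * ((1 - s * v) powr (t - 1) * c)"
    proof -
      have "norm (exp ((t - 1) *\<^sub>R ?l)) \<le> exp (norm ((t - 1) *\<^sub>R ?l))"
        by (rule norm_exp)
      also have "norm ((t - 1) *\<^sub>R ?l) = (1 - t) * norm ?l"
        using t by simp
      also have "(1 - t) * norm ?l \<le> (1 - t) * (- ln (1 - s * v))"
        using norm_ln1p_le[OF norm_scaled_lt[OF s']] t s by (intro mult_left_mono) (auto simp: v_def)
      also have "exp ((1 - t) * (- ln (1 - s * v))) = (1 - s * v) powr (t - 1)"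
        using sv[OF s'] by (simp add: powr_def algebra_simps)
      finally show ?thesis
        using t by (intro mult_left_mono mult_right_mono) (auto simp: c_def)
    qed
    finally show "norm (exp (t *\<^sub>R ?l) * (t *\<^sub>R (y * neumann (s *\<^sub>R y))) * z)
        \<le> c * t * (1 - s * v) powr (t - 1)"
      by (simp add: mult_ac)
  qed simp
  also have "?p 1 - ?p 0 = c * ((1 - (1 - v) powr t) / v)"
    using v by (simp add: diff_divide_distrib right_diff_distrib)
  also have "\<dots> \<le> c * 1"
  proof -
    have "(1 - v) powr 1 \<le> (1 - v) powr t"
      using v t by (intro powr_mono') auto
    then show ?thesis using v by (intro mult_left_mono) (auto simp: c_def)
  qed
  finally show ?thesis by (simp add: c_def left_diff_distrib)
qed simp

text \<open>
  Conjugation with the involution \<open>u\<close> inverts \<open>1 + y\<close>. Since \<open>u y u\<close>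
  may have norm at least \<open>1\<close>, the identity \<open>ln (T\<^sup>-\<^sup>1) = - ln T\<close> cannot be
  read off from power series; it is derived from the integral of
  \<open>(T - 1) (1 + s (T - 1))\<^sup>-\<^sup>1\<close> over \<open>s \<in> [0, 1]\<close>, in which replacing
  \<open>T\<close> by \<open>T\<^sup>-\<^sup>1\<close> amounts to substituting \<open>1 - s\<close> for
  \<open>s\<close> and changing the sign.
\<close>
lemma ln1p_inverse_conjugate:
  assumes u: "u * u = 1" and inv: "u * (1 + y) * u * (1 + y) = 1"
  shows "u * ln1p y * u = - ln1p y"
proof -
  define y' where "y' = u * y * u"
  have T': "u * (1 + y) * u = 1 + y'"
    by (simp add: y'_def algebra_simps u)
  with inv have left: "(1 + y') * (1 + y) = 1" by simp
  have "(1 + y) * (1 + y') = u * (u * (1 + y) * u * (1 + y)) * u"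
    by (simp only: T'[symmetric] mult.assoc[symmetric] u mult_1_left)
  then have right: "(1 + y) * (1 + y') = 1" by (simp add: inv u)
  have sum: "y + y' + y * y' = 0" and "y + y' + y' * y = 0"
    using left right by (simp_all add: algebra_simps)
  then have comm: "y' * y = y * y'"
    by (metis add_left_cancel)
  let ?g = "\<lambda>s. u * ln1p (s *\<^sub>R y) * u - ln1p ((1 - s) *\<^sub>R y)"
  have "(?g has_vector_derivative 0) (at s within {0..1})" if s: "s \<in> {0..1}" for s
  proof -
    have s': "1 - s \<in> {0..1}" using s by auto
    let ?n = "u * neumann (s *\<^sub>R y) * u" and ?m = "neumann ((1 - s) *\<^sub>R y)"
    have d1: "((\<lambda>s. u * ln1p (s *\<^sub>R y) * u) has_vector_derivative u * (y * neumann (s *\<^sub>R y)) * u)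
        (at s within {0..1})"
      by (rule bounded_linear.has_vector_derivative[OF bounded_linear_mult_left],
          rule bounded_linear.has_vector_derivative[OF bounded_linear_mult_right],
          rule ln1p_has_vector_derivative[OF y s])
    have d2: "((\<lambda>s. ln1p ((1 - s) *\<^sub>R y)) has_vector_derivative (-1) *\<^sub>R (y * ?m)) (at s within {0..1})"
    proof -
      have "((\<lambda>s. 1 - s) has_vector_derivative -1) (at s within {0..1})"
        by (auto intro!: derivative_eq_intros)
      moreover have "(\<lambda>s::real. 1 - s) ` {0..1} = {0..1}"
        using image_diff_atLeastAtMost[of 1 0 "1::real"] by simp
      ultimately show ?thesis
        using vector_diff_chain_within[of "\<lambda>s. 1 - s" "-1" s "{0..1}" "\<lambda>s. ln1p (s *\<^sub>R y)" "y * ?m"]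
          ln1p_has_vector_derivative[OF y s'] by (simp add: o_def)
    qed
    have nl: "?n * (1 + s *\<^sub>R y') = 1"
    proof -
      have "1 + s *\<^sub>R y' = u * (1 + s *\<^sub>R y) * u"
        by (simp add: y'_def algebra_simps u)
      then have "?n * (1 + s *\<^sub>R y') = u * (neumann (s *\<^sub>R y) * (u * u) * (1 + s *\<^sub>R y)) * u"
        by (simp only: mult.assoc)
      then show ?thesis
        using neumann(1)[OF norm_scaled_lt[OF s]] by (simp add: u)
    qed
    have nr: "(1 + s *\<^sub>R y') * ?n = 1"
    proof -
      have "1 + s *\<^sub>R y' = u * (1 + s *\<^sub>R y) * u"
        by (simp add: y'_def algebra_simps u)
      then have "(1 + s *\<^sub>R y') * ?n = u * ((1 + s *\<^sub>R y) * (u * u) * neumann (s *\<^sub>R y)) * u"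
        by (simp only: mult.assoc)
      then show ?thesis
        using neumann(2)[OF norm_scaled_lt[OF s]] by (simp add: u)
    qed
    have mr: "(1 + (1 - s) *\<^sub>R y) * ?m = 1"
      by (rule neumann(2)[OF norm_scaled_lt[OF s']])
    \<comment> \<open>This is \<open>y' (1 + s y')\<^sup>-\<^sup>1 = - y (1 + (1 - s) y)\<^sup>-\<^sup>1\<close>
      after clearing denominators.\<close>
    have cross: "y' * (1 + (1 - s) *\<^sub>R y) = - ((1 + s *\<^sub>R y') * y)"
    proof -
      have "y' * (1 + (1 - s) *\<^sub>R y) + (1 + s *\<^sub>R y') * y = y + y' + y * y'"
        by (simp add: algebra_simps comm)
      then show ?thesis using sum by (simp add: add_eq_0_iff)
    qed
    have "u * (y * neumann (s *\<^sub>R y)) * u = y' * ?n"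
      by (simp add: y'_def mult.assoc) (simp add: mult.assoc[symmetric] u)
    also have "\<dots> = ?n * ((1 + s *\<^sub>R y') * y') * ?n"
      using nl by (simp add: mult.assoc[symmetric])
    also have "\<dots> = ?n * y' * ((1 + s *\<^sub>R y') * ?n)"
      by (simp add: algebra_simps)
    also have "\<dots> = ?n * (y' * (1 + (1 - s) *\<^sub>R y)) * ?m"
      using nr mr by (simp add: mult.assoc)
    also have "\<dots> = - (y * ?m)"
      using nl by (simp add: cross mult.assoc[symmetric])
    finally have "u * (y * neumann (s *\<^sub>R y)) * u - (-1) *\<^sub>R (y * ?m) = 0" by simp
    with has_vector_derivative_diff[OF d1 d2] show ?thesis by simp
  qed
  then obtain c where "\<And>s. s \<in> {0..1} \<Longrightarrow> ?g s = c"
    using has_vector_derivative_zero_constant[of "{0..1}" ?g] convex_real_interval(5) by blast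
  then have "?g 1 = ?g 0"
    by (metis atLeastAtMost_iff order_refl zero_le_one)
  then show ?thesis by simp
qed

end

section \<open>Bounded operators inside a unital Banach algebra\<close>

text \<open>
  The operators on the zero space satisfy \<open>1 = 0\<close>, so they do not form a normed algebra
  whose unit has norm \<open>1\<close>. The product of the operators with the scalars, under the
  maximum norm, is such an algebra over every space. The projection \<open>op_part\<close> is a
  unital homomorphism that carries the exponential to \<^const>\<open>op_exp\<close>, and
  \<open>op_embed\<close> is an isometric section of it which is multiplicative but not unital.
\<close>
declare [[typedef_overloaded]]

datatype (dead 'a::real_normed_vector) op_algebra =
  Op_pair (op_part: "'a \<Rightarrow>\<^sub>L 'a") (scalar_part: real)

lemma op_algebra_eq_iff: "x = y \<longleftrightarrow> op_part x = op_part y \<and> scalar_part x = scalar_part y"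
  by (cases x; cases y) simp

instantiation op_algebra :: (real_normed_vector) "{ring_1,real_vector}"
begin

definition zero_op_algebra :: "'a op_algebra" where "0 = Op_pair 0 0"
definition one_op_algebra :: "'a op_algebra" where "1 = Op_pair id_blinfun 1"
definition plus_op_algebra :: "'a op_algebra \<Rightarrow> 'a op_algebra \<Rightarrow> 'a op_algebra" where
  "x + y = Op_pair (op_part x + op_part y) (scalar_part x + scalar_part y)"
definition minus_op_algebra :: "'a op_algebra \<Rightarrow> 'a op_algebra \<Rightarrow> 'a op_algebra" where
  "x - y = Op_pair (op_part x - op_part y) (scalar_part x - scalar_part y)"
definition uminus_op_algebra :: "'a op_algebra \<Rightarrow> 'a op_algebra" where
  "- x = Op_pair (- op_part x) (- scalar_part x)"
definition scaleR_op_algebra :: "real \<Rightarrow> 'a op_algebra \<Rightarrow> 'a op_algebra" where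
  "c *\<^sub>R x = Op_pair (c *\<^sub>R op_part x) (c * scalar_part x)"
definition times_op_algebra :: "'a op_algebra \<Rightarrow> 'a op_algebra \<Rightarrow> 'a op_algebra" where
  "x * y = Op_pair (op_part x o\<^sub>L op_part y) (scalar_part x * scalar_part y)"

lemmas op_algebra_defs = zero_op_algebra_def one_op_algebra_def plus_op_algebra_def
  minus_op_algebra_def uminus_op_algebra_def scaleR_op_algebra_def times_op_algebra_def

instance
  by standard (auto simp: op_algebra_defs op_algebra_eq_iff algebra_simps blinfun.bilinear_simps
      intro!: blinfun_eqI)

end

instantiation op_algebra :: (real_normed_vector) real_normed_algebra_1
begin

definition norm_op_algebra :: "'a op_algebra \<Rightarrow> real" where
  "norm x = max (norm (op_part x)) \<bar>scalar_part x\<bar>"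
definition sgn_op_algebra :: "'a op_algebra \<Rightarrow> 'a op_algebra" where
  "sgn_op_algebra x = x /\<^sub>R norm x"
definition dist_op_algebra :: "'a op_algebra \<Rightarrow> 'a op_algebra \<Rightarrow> real" where
  "dist_op_algebra x y = norm (x - y)"
definition uniformity_op_algebra :: "('a op_algebra \<times> 'a op_algebra) filter" where
  "uniformity_op_algebra = (INF e\<in>{0<..}. principal {(x, y). dist x y < e})"
definition open_op_algebra :: "'a op_algebra set \<Rightarrow> bool" where
  "open_op_algebra U = (\<forall>x\<in>U. \<forall>\<^sub>F (x', y) in uniformity. x' = x \<longrightarrow> y \<in> U)"

instance
proof
  fix x y :: "'a op_algebra" and r :: real
  show "dist x y = norm (x - y)" by (rule dist_op_algebra_def)
  show "sgn x = x /\<^sub>R norm x" by (rule sgn_op_algebra_def)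
  show "(uniformity :: ('a op_algebra \<times> 'a op_algebra) filter) = (INF e\<in>{0<..}. principal {(x, y). dist x y < e})"
    by (rule uniformity_op_algebra_def)
  show "open U = (\<forall>x\<in>U. \<forall>\<^sub>F (x', y) in uniformity. x' = x \<longrightarrow> y \<in> U)" for U :: "'a op_algebra set"
    by (rule open_op_algebra_def)
  show "r *\<^sub>R x * y = r *\<^sub>R (x * y)" "x * r *\<^sub>R y = r *\<^sub>R (x * y)"
    by (auto simp: op_algebra_defs blinfun.bilinear_simps intro!: blinfun_eqI)
  show "(norm x = 0) = (x = 0)"
    by (auto simp: norm_op_algebra_def op_algebra_defs op_algebra_eq_iff max_def split: if_splits)
  show "norm (x + y) \<le> norm x + norm y"
    using norm_triangle_ineq[of "op_part x" "op_part y"]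
    by (auto simp: norm_op_algebra_def op_algebra_defs)
  show "norm (r *\<^sub>R x) = \<bar>r\<bar> * norm x"
    by (auto simp: norm_op_algebra_def op_algebra_defs abs_mult max_mult_distrib_left)
  show "norm (x * y) \<le> norm x * norm y"
  proof -
    have "norm (op_part x o\<^sub>L op_part y) \<le> norm (op_part x) * norm (op_part y)"
      by (rule norm_blinfun_compose)
    also have "\<dots> \<le> norm x * norm y"
      by (intro mult_mono) (auto simp: norm_op_algebra_def le_max_iff_disj)
    moreover have "\<bar>scalar_part x * scalar_part y\<bar> \<le> norm x * norm y"
      unfolding abs_mult by (intro mult_mono) (auto simp: norm_op_algebra_def le_max_iff_disj)
    ultimately show ?thesis
      unfolding norm_op_algebra_def[of "x * y"] by (simp add: times_op_algebra_def)
  qed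
  show "norm (1 :: 'a op_algebra) = 1"
    using norm_blinfun_id_le[where 'a='a] by (auto simp: norm_op_algebra_def one_op_algebra_def)
qed

end

definition op_embed :: "('a::real_normed_vector \<Rightarrow>\<^sub>L 'a) \<Rightarrow> 'a op_algebra" where
  "op_embed T = Op_pair T 0"

lemma op_part_simps [simp]:
  "op_part 0 = 0" "op_part 1 = id_blinfun" "op_part (x + y) = op_part x + op_part y"
  "op_part (x - y) = op_part x - op_part y" "op_part (- x) = - op_part x"
  "op_part (c *\<^sub>R x) = c *\<^sub>R op_part x" "op_part (x * y) = op_part x o\<^sub>L op_part y"
  "op_part (op_embed T) = T"
  by (simp_all add: op_algebra_defs op_embed_def)

lemma op_embed_simps:
  "op_embed 0 = 0" "op_embed (T + U) = op_embed T + op_embed U"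
  "op_embed (T - U) = op_embed T - op_embed U" "op_embed (- T) = - op_embed T"
  "op_embed (c *\<^sub>R T) = c *\<^sub>R op_embed T" "op_embed (T o\<^sub>L U) = op_embed T * op_embed U"
  "norm (op_embed T) = norm T"
  by (simp_all add: op_algebra_defs op_embed_def norm_op_algebra_def)

lemma norm_op_part_le: "norm (op_part x) \<le> norm x"
  and norm_scalar_part_le: "\<bar>scalar_part x\<bar> \<le> norm x"
  by (simp_all add: norm_op_algebra_def)

lemma bounded_linear_op_part: "bounded_linear op_part"
  by (rule bounded_linear_intro[of _ 1]) (auto simp: norm_op_part_le)

lemma bounded_linear_scalar_part: "bounded_linear scalar_part"
  by (rule bounded_linear_intro[of _ 1]) (auto simp: norm_scalar_part_le op_algebra_defs)

instance op_algebra :: (banach) banach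
proof
  fix X :: "nat \<Rightarrow> 'a op_algebra"
  assume X: "Cauchy X"
  have "Cauchy (\<lambda>n. op_part (X n))" "Cauchy (\<lambda>n. scalar_part (X n))"
    using bounded_linear.Cauchy[OF bounded_linear_op_part X]
      bounded_linear.Cauchy[OF bounded_linear_scalar_part X] by auto
  then obtain T c where T: "(\<lambda>n. op_part (X n)) \<longlonglongrightarrow> T" and c: "(\<lambda>n. scalar_part (X n)) \<longlonglongrightarrow> c"
    using Cauchy_convergent convergent_def by metis
  let ?l = "Op_pair T c"
  have l: "op_part ?l = T" "scalar_part ?l = c"
    by simp_all
  have s: "scalar_part (x - y) = scalar_part x - scalar_part y" for x y :: "'a op_algebra"
    by (simp add: op_algebra_defs)
  have "(\<lambda>n. norm (X n - ?l)) \<longlonglongrightarrow> max (norm (T - T)) \<bar>c - c\<bar>"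
    unfolding norm_op_algebra_def op_part_simps s l by (intro tendsto_intros T c)
  then have "X \<longlonglongrightarrow> ?l"
    by (simp add: LIM_zero_iff tendsto_norm_zero_iff)
  then show "convergent X" by (rule convergentI)
qed

lemma op_power_op_part: "op_power (op_part x) n = op_part (x ^ n)"
  by (induction n) (simp_all add: op_power_def)

lemma op_exp_op_part: "op_exp (op_part x) = op_part (exp x)"
  for x :: "'a::banach op_algebra"
proof -
  have "(\<lambda>n. op_part (x ^ n /\<^sub>R fact n)) sums op_part (exp x)"
    by (intro bounded_linear.sums[OF bounded_linear_op_part] exp_converges)
  then show ?thesis
    by (simp add: op_exp_def op_power_op_part inverse_eq_divide sums_iff)
qed

lemma exp_conj_op_part:
  "exp_conj (op_part x) (op_part q) = op_part (exp x * q * exp (- x))"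
  for x q :: "'a::banach op_algebra"
  by (simp add: exp_conj_def op_exp_op_part flip: op_part_simps(5))

instance complex_hilbert \<subseteq> banach ..

section \<open>Adjoints on a complex Hilbert space\<close>

text \<open>
  For \<open>f \<noteq> 0\<close> the representing vector is a multiple of the point \<open>z\<close> of least norm in the closed
  hyperplane \<open>f = 1\<close>; a minimizing sequence converges by the parallelogram law.
\<close>
lemma Riesz_representation:
  fixes f :: "'a::{real_inner,complete_space} \<Rightarrow> real"
  assumes f: "bounded_linear f"
  obtains z where "\<And>x. f x = inner x z"
proof (cases "\<forall>x. f x = 0")
  case True
  then show ?thesis using that[of 0] by simp
next
  case False
  then obtain w0 where "f w0 \<noteq> 0" by blast
  interpret f: bounded_linear f by fact
  define C where "C = {x. f x = 1}"
  have "w0 /\<^sub>R f w0 \<in> C"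
    using \<open>f w0 \<noteq> 0\<close> by (simp add: C_def f.scaleR)
  then have ne: "(\<lambda>x. (norm x)\<^sup>2) ` C \<noteq> {}" by blast
  define d where "d = (INF x\<in>C. (norm x)\<^sup>2)"
  have bdd: "bdd_below ((\<lambda>x. (norm x)\<^sup>2) ` C)"
    by (rule bdd_belowI[of _ 0]) auto
  have d: "d \<le> (norm x)\<^sup>2" if "x \<in> C" for x
    unfolding d_def using that bdd by (rule cINF_lower[rotated])
  have "\<exists>x\<in>C. (norm x)\<^sup>2 < d + inverse (real (Suc n))" for n
    using cInf_lessD[OF ne, of "d + inverse (real (Suc n))"] by (auto simp: d_def)
  then obtain X where X: "\<And>n. X n \<in> C" "\<And>n. (norm (X n))\<^sup>2 < d + inverse (real (Suc n))"
    by metis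
  \<comment> \<open>The midpoint of two points of the hyperplane lies in it, so its norm is bounded below.\<close>
  have par: "(norm (x - y))\<^sup>2 \<le> 2 * (norm x)\<^sup>2 + 2 * (norm y)\<^sup>2 - 4 * d" if "x \<in> C" "y \<in> C" for x y
  proof -
    have "(1/2) *\<^sub>R (x + y) \<in> C" using that by (simp add: C_def f.scaleR f.add)
    from d[OF this] have "4 * d \<le> (norm (x + y))\<^sup>2" by (simp add: power_mult_distrib power_divide)
    moreover have "(norm (x - y))\<^sup>2 + (norm (x + y))\<^sup>2 = 2 * (norm x)\<^sup>2 + 2 * (norm y)\<^sup>2"
      by (simp add: power2_norm_eq_inner inner_diff inner_add inner_commute)
    ultimately show ?thesis by linarith
  qed
  have "Cauchy X"
  proof (rule CauchyI)
    fix e :: real assume "e > 0"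
    then obtain N where N: "inverse (real (Suc N)) < e\<^sup>2 / 4"
      using reals_Archimedean[of "e\<^sup>2 / 4"] by auto
    have "norm (X m - X n) < e" if "m \<ge> N" "n \<ge> N" for m n
    proof -
      have *: "inverse (real (Suc k)) \<le> inverse (real (Suc N))" if "k \<ge> N" for k
        using that by (intro le_imp_inverse_le) auto
      have "(norm (X m - X n))\<^sup>2 < e\<^sup>2"
        using par[OF X(1)[of m] X(1)[of n]] X(2)[of m] X(2)[of n] *[OF that(1)] *[OF that(2)] N
        by linarith
      then show ?thesis using \<open>e > 0\<close> by (simp add: power2_less_imp_less)
    qed
    then show "\<exists>M. \<forall>m\<ge>M. \<forall>n\<ge>M. norm (X m - X n) < e" by blast
  qed
  then obtain z where z: "X \<longlonglongrightarrow> z"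
    using Cauchy_convergent convergent_def by blast
  have fz: "f z = 1"
    using LIMSEQ_unique[OF f.tendsto[OF z]] X(1) by (simp add: C_def)
  have "(\<lambda>n. (norm (X n))\<^sup>2) \<longlonglongrightarrow> (norm z)\<^sup>2" by (intro tendsto_intros z)
  moreover have "(\<lambda>n. d + inverse (real (Suc n))) \<longlonglongrightarrow> d + 0"
    by (intro tendsto_intros LIMSEQ_inverse_real_of_nat)
  ultimately have zd: "(norm z)\<^sup>2 \<le> d"
    using X(2) by (intro LIMSEQ_le) (auto intro: less_imp_le)
  \<comment> \<open>The norm on the line \<open>z + t k\<close> is minimal at \<open>t = 0\<close>;
    the chosen \<open>t\<close> is the foot of the perpendicular.\<close>
  have orth: "inner k z = 0" if k: "f k = 0" for k
  proof (cases "k = 0")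
    case False
    define t where "t = - inner k z / inner k k"
    have kk: "inner k k > 0" using False by simp
    have "z + t *\<^sub>R k \<in> C" using k fz by (simp add: C_def f.add f.scaleR)
    then have "(norm z)\<^sup>2 \<le> (norm (z + t *\<^sub>R k))\<^sup>2" using order_trans[OF zd d] by blast
    also have "\<dots> = (norm z)\<^sup>2 + 2 * t * inner k z + t * t * inner k k"
      by (simp add: power2_norm_eq_inner inner_add inner_commute algebra_simps)
    also have "\<dots> = (norm z)\<^sup>2 - (inner k z)\<^sup>2 / inner k k"
      using kk by (simp add: t_def power2_eq_square field_simps)
    finally have "(inner k z)\<^sup>2 \<le> 0" using kk by (simp add: divide_le_0_iff)
    then show ?thesis by simp
  qed simp
  have "z \<noteq> 0" using fz f.zero by auto
  have "f x = inner x (z /\<^sub>R (inner z z))" for x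
  proof -
    have "inner (x - f x *\<^sub>R z) z = 0"
      by (rule orth) (simp add: f.diff f.scaleR fz)
    then show ?thesis using \<open>z \<noteq> 0\<close> by (simp add: inner_diff_left field_simps)
  qed
  then show ?thesis by (rule that)
qed

lemma eq_if_inner_eq:
  fixes a b :: "'a::real_inner"
  assumes "\<And>x. inner x a = inner x b"
  shows "a = b"
  using vector_eq_ldot[of a b] assms by blast

lemma real_adjoint_exists:
  fixes T :: "'a::{real_inner,complete_space} \<Rightarrow>\<^sub>L 'a"
  obtains S :: "'a \<Rightarrow>\<^sub>L 'a" where "\<And>x y. inner (T x) y = inner x (S y)"
proof -
  have "\<exists>z. \<forall>x. inner (T x) y = inner x z" for y
    using Riesz_representation[OF bounded_linear_compose[OF bounded_linear_inner_left
          blinfun.bounded_linear_right[of T]]] by metis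
  then obtain S where S: "\<And>x y. inner (T x) y = inner x (S y)" by metis
  have "bounded_linear S"
  proof (rule bounded_linear_intro)
    show "S (x + y) = S x + S y" for x y
      by (rule eq_if_inner_eq) (simp add: inner_add_right flip: S)
    show "S (r *\<^sub>R x) = r *\<^sub>R S x" for r x
      by (rule eq_if_inner_eq) (simp flip: S)
    show "norm (S y) \<le> norm y * norm T" for y
    proof -
      have "norm (S y) * norm (S y) = inner (T (S y)) y"
        by (simp add: S power2_norm_eq_inner flip: power2_eq_square)
      also have "\<dots> \<le> norm (T (S y)) * norm y" by (rule norm_cauchy_schwarz)
      also have "\<dots> \<le> norm (S y) * (norm y * norm T)"
        using mult_right_mono[OF norm_blinfun[of T "S y"], of "norm y"] by (simp add: mult_ac)
      finally show ?thesis
        by (cases "norm (S y) = 0") (auto simp: mult_le_cancel_left)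
    qed
  qed
  then have "inner (T x) y = inner x (Blinfun S y)" for x y
    by (simp add: S bounded_linear_Blinfun_apply)
  then show ?thesis by (rule that)
qed

lemma cinner_scaleC_right: "cinner x (c *\<^sub>C y) = cnj c * cinner x y"
  using cinner_commute[of x "c *\<^sub>C y"] cinner_commute[of x y] by (simp add: cinner_scaleC_left)

lemma inner_scaleC_left: "inner (c *\<^sub>C x) y = inner x (cnj c *\<^sub>C y)"
  by (simp add: cinner_scaleC_left cinner_scaleC_right flip: Re_cinner)

text \<open>
  The complex inner product is determined by its real part. This reduces statements about adjoints
  to the real inner product.
\<close>
lemma cinner_conv_inner: "cinner x y = Complex (inner x y) (inner x (\<i> *\<^sub>C y))"
  by (simp add: complex_eq_iff cinner_scaleC_right flip: Re_cinner)

lemma norm_scaleC: "norm (c *\<^sub>C x) = cmod c * norm x"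
proof -
  have "(norm (c *\<^sub>C x))\<^sup>2 = Re (cnj c * c * cinner x x)"
    by (simp add: cinner_scaleC_left cinner_scaleC_right power2_norm_eq_inner mult_ac flip: Re_cinner)
  also have "cnj c * c = of_real ((cmod c)\<^sup>2)"
    by (simp only: complex_norm_square mult.commute)
  finally have "(norm (c *\<^sub>C x))\<^sup>2 = (cmod c * norm x)\<^sup>2"
    by (simp add: power_mult_distrib power2_norm_eq_inner Re_cinner)
  then show ?thesis by simp
qed

definition scaleC_op :: "complex \<Rightarrow> ('a::complex_hilbert \<Rightarrow>\<^sub>L 'a)" where
  "scaleC_op c = Blinfun (scaleC c)"

lemma scaleC_op_apply [simp]: "scaleC_op c x = c *\<^sub>C x"
proof -
  have "bounded_linear (scaleC c :: 'a \<Rightarrow> 'a)"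
  proof (rule bounded_linear_intro)
    show "c *\<^sub>C (r *\<^sub>R x) = r *\<^sub>R (c *\<^sub>C x)" for r and x :: 'a
      by (simp add: scaleC_scaleC mult.commute flip: scaleC_of_real)
    show "norm (c *\<^sub>C x) \<le> norm x * cmod c" for x :: 'a
      by (simp add: norm_scaleC)
  qed (rule scaleC_add_right)
  then show ?thesis by (simp add: scaleC_op_def bounded_linear_Blinfun_apply)
qed

text \<open>
  Complex linearity as commutation with the operators \<^term>\<open>scaleC_op c\<close>: it is
  inherited by everything that is given by a power series.
\<close>
lemma bounded_ops_iff_commutes:
  "T \<in> bounded_ops \<longleftrightarrow> (\<forall>c. scaleC_op c o\<^sub>L T = T o\<^sub>L scaleC_op c)"
proof
  assume "\<forall>c. scaleC_op c o\<^sub>L T = T o\<^sub>L scaleC_op c"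
  then have "(scaleC_op c o\<^sub>L T) x = (T o\<^sub>L scaleC_op c) x" for c x by simp
  then show "T \<in> bounded_ops" by (simp add: bounded_ops_def)
qed (auto simp: bounded_ops_def intro!: blinfun_eqI)

lemma adj_inner:
  assumes T: "T \<in> bounded_ops"
  shows "inner (T x) (y::'a::complex_hilbert) = inner x (adj T y)"
proof -
  obtain S :: "'a \<Rightarrow>\<^sub>L 'a" where S: "\<And>x y. inner (T x) y = inner x (S y)" by (rule real_adjoint_exists[of T]) blast
  have Sc: "S (c *\<^sub>C y) = c *\<^sub>C S y" for c y
  proof (rule eq_if_inner_eq)
    fix x
    have "inner x (S (c *\<^sub>C y)) = inner (T (cnj c *\<^sub>C x)) y"
      using T by (simp add: bounded_ops_def inner_scaleC_left flip: S)
    then show "inner x (S (c *\<^sub>C y)) = inner x (c *\<^sub>C S y)"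
      by (simp add: S inner_scaleC_left)
  qed
  have "adj T = S"
    unfolding adj_def
  proof (rule the_equality)
    show "S \<in> bounded_ops \<and> (\<forall>x y. cinner (T x) y = cinner x (S y))"
      by (simp add: bounded_ops_def Sc cinner_conv_inner S)
    show "S' = S" if "S' \<in> bounded_ops \<and> (\<forall>x y. cinner (T x) y = cinner x (S' y))" for S'
      by (rule blinfun_eqI, rule eq_if_inner_eq) (metis that S Re_cinner)
  qed
  then show ?thesis by (simp add: S)
qed

text \<open>
  For operators this says \<open>T\<^sup>* A = A T'\<close>: \<open>T'\<close> is an adjoint of
  \<open>T\<close> for the form \<open>\<langle>u, A v\<rangle>\<close>. As a condition on pairs it makes sense
  without knowing that every \<open>T\<close> has such an adjoint.
\<close>
definition adjoint_pair_wrt ::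
  "('a::real_inner \<Rightarrow>\<^sub>L 'a) \<Rightarrow> ('a \<Rightarrow>\<^sub>L 'a) \<Rightarrow> ('a \<Rightarrow>\<^sub>L 'a) \<Rightarrow> bool" where
  "adjoint_pair_wrt A T T' \<longleftrightarrow> (\<forall>u v. inner (T u) (A v) = inner u (A (T' v)))"

lemma compatible_Gr_iff:
  "Q \<in> compatible_Gr A \<longleftrightarrow> Q \<in> idempotents \<and> adjoint_pair_wrt A Q Q"
proof -
  have "adj Q o\<^sub>L A = A o\<^sub>L Q \<longleftrightarrow> adjoint_pair_wrt A Q Q" if "Q \<in> bounded_ops"
  proof
    assume "adj Q o\<^sub>L A = A o\<^sub>L Q"
    then have "adj Q (A v) = A (Q v)" for v
      by (metis blinfun_apply_blinfun_compose)
    then show "adjoint_pair_wrt A Q Q"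
      unfolding adjoint_pair_wrt_def by (simp add: adj_inner[OF that])
  next
    assume "adjoint_pair_wrt A Q Q"
    then have "inner u (adj Q (A v)) = inner u (A (Q v))" for u v
      unfolding adjoint_pair_wrt_def by (simp flip: adj_inner[OF that])
    then have "adj Q (A v) = A (Q v)" for v
      by (rule eq_if_inner_eq)
    then show "adj Q o\<^sub>L A = A o\<^sub>L Q"
      by (intro blinfun_eqI) simp
  qed
  then show ?thesis by (auto simp: compatible_Gr_def idempotents_def)
qed

lemma adjoint_pair_wrt_compose:
  "adjoint_pair_wrt A S S' \<Longrightarrow> adjoint_pair_wrt A T T' \<Longrightarrow> adjoint_pair_wrt A (S o\<^sub>L T) (T' o\<^sub>L S')"
  by (simp add: adjoint_pair_wrt_def)

section \<open>Co-diagonal exponents\<close>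

lemma reflection_square:
  "q * q = q \<Longrightarrow> (q + q - 1) * (q + q - 1) = (1 :: 'b::ring_1)"
  by (simp add: algebra_simps)

lemma double_eq_iff: "a + a = b + b \<longleftrightarrow> a = (b :: 'b::real_vector)"
  by (metis scaleR_2 scaleR_left_imp_eq zero_neq_numeral)

text \<open>
  The equation \<open>x = q x + x q\<close> is the form in which co-diagonality is used throughout;
  \<open>q + q - 1\<close> is the symmetry of the idempotent \<open>q\<close>.
\<close>
lemma codiagonal_iff_anticommutes:
  fixes q x :: "'b::real_algebra_1"
  shows "x = q * x + x * q \<longleftrightarrow> (q + q - 1) * x = - (x * (q + q - 1))"
proof -
  have "(q + q - 1) * x = - (x * (q + q - 1)) \<longleftrightarrow> (q * x + x * q) + (q * x + x * q) = x + x"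
    by (simp add: algebra_simps eq_neg_iff_add_eq_0 add_eq_0_iff2)
  then show ?thesis unfolding double_eq_iff by auto
qed

text \<open>
  Moving \<open>e\<^bsup>-x\<^esup>\<close> past the anticommuting symmetry turns it into
  \<open>e\<^sup>x\<close>, so a geodesic of idempotents becomes a one-parameter group times a fixed
  symmetry.
\<close>
lemma exp_conjugate_idempotent:
  fixes q x :: "'b::{real_normed_algebra_1,banach}"
  assumes x: "x = q * x + x * q"
  shows "exp x * q * exp (- x) - q = (1/2) *\<^sub>R ((exp (2 *\<^sub>R x) - 1) * (q + q - 1))"
proof -
  let ?s = "q + q - 1"
  have "?s * (- x) = x * ?s"
    using x[unfolded codiagonal_iff_anticommutes] by simp
  then have "?s * exp (- x) = exp x * ?s" by (rule exp_intertwines)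
  then have "exp x * ?s * exp (- x) = exp x * exp x * ?s" by (simp only: mult.assoc)
  also have "exp x * exp x = exp (2 *\<^sub>R x)"
    by (simp add: scaleR_2 exp_add_commuting)
  finally have "exp x * ?s * exp (- x) - ?s = (exp (2 *\<^sub>R x) - 1) * ?s"
    by (simp add: left_diff_distrib)
  moreover have "exp x * ?s * exp (- x) - ?s = 2 *\<^sub>R (exp x * q * exp (- x) - q)"
    by (simp add: algebra_simps scaleR_2 exp_minus_inverse)
  ultimately show ?thesis by (metis scaleR_half_double scaleR_2)
qed

lemma reflection_product:
  fixes p q :: "'b::real_algebra_1"
  assumes q: "q * q = q"
  shows "((p + p - 1) * (q + q - 1) - 1) * (q + q - 1) = 2 *\<^sub>R (p - q)"
    "2 *\<^sub>R (p - q) * (q + q - 1) = (p + p - 1) * (q + q - 1) - 1"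
proof -
  have "((p + p - 1) * (q + q - 1) - 1) * (q + q - 1) =
      (p + p - 1) * ((q + q - 1) * (q + q - 1)) - (q + q - 1)"
    by (simp only: left_diff_distrib mult.assoc mult_1_left)
  then show eq: "((p + p - 1) * (q + q - 1) - 1) * (q + q - 1) = 2 *\<^sub>R (p - q)"
    by (simp add: reflection_square[OF q] scaleR_2)
  show "2 *\<^sub>R (p - q) * (q + q - 1) = (p + p - 1) * (q + q - 1) - 1"
    unfolding eq[symmetric] by (simp add: mult.assoc reflection_square[OF q])
qed

text \<open>
  Half the logarithm of the product of two symmetries is the exponent of a geodesic between the
  idempotents, and on this geodesic the distance from the starting point never exceeds the distance
  of the end points.
\<close>
lemma half_log_of_reflection_product:
  fixes p q :: "'b::{real_normed_algebra_1,banach}"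
  defines "y \<equiv> (p + p - 1) * (q + q - 1) - 1"
  defines "x \<equiv> (1/2) *\<^sub>R ln1p y"
  assumes q: "q * q = q" and p: "p * p = p" and y: "norm y < 1"
  shows "(q + q - 1) * ln1p y * (q + q - 1) = - ln1p y" "x = q * x + x * q"
    "exp x * q * exp (- x) = p"
    "t \<in> {0..1} \<Longrightarrow> norm (exp (t *\<^sub>R x) * q * exp (- (t *\<^sub>R x)) - q) \<le> norm (p - q)"
proof -
  let ?s = "q + q - 1" and ?r = "p + p - 1"
  have ss: "?s * ?s = 1" and rr: "?r * ?r = 1"
    by (simp_all only: reflection_square q p)
  have "?s * (1 + y) * ?s * (1 + y) = ?s * ?r * (?s * ?s) * ?r * ?s"
    by (simp only: y_def add_diff_cancel_left' add_diff_eq mult.assoc)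
  also have "\<dots> = ?s * (?r * ?r) * ?s" by (simp only: ss mult_1_right mult.assoc)
  finally have "?s * (1 + y) * ?s * (1 + y) = 1" by (simp only: ss rr mult_1_right)
  then show anti: "?s * ln1p y * ?s = - ln1p y"
    by (rule ln1p_inverse_conjugate[OF y ss])
  have "?s * x * ?s = - x"
    using anti by (simp only: x_def mult_scaleR_left mult_scaleR_right scaleR_minus_right)
  then have "?s * x * (?s * ?s) = - (x * ?s)"
    by (simp only: mult.assoc[symmetric] mult_minus_left)
  then show x: "x = q * x + x * q"
    unfolding codiagonal_iff_anticommutes ss by simp
  have "exp x * q * exp (- x) - q = (1/2) *\<^sub>R (y * ?s)"
    unfolding exp_conjugate_idempotent[OF x] by (simp add: x_def exp_ln1p[OF y])
  then show "exp x * q * exp (- x) = p"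
    by (simp add: y_def reflection_product(1)[OF q])
  assume t: "t \<in> {0..1}"
  have "t *\<^sub>R x = t *\<^sub>R (q * x + x * q)" by (rule arg_cong[OF x])
  also have "\<dots> = q * (t *\<^sub>R x) + (t *\<^sub>R x) * q" by (simp add: scaleR_add_right)
  finally have tx: "t *\<^sub>R x = q * (t *\<^sub>R x) + (t *\<^sub>R x) * q" .
  have "2 *\<^sub>R t *\<^sub>R x = t *\<^sub>R ln1p y" by (simp add: x_def)
  then have "norm (exp (t *\<^sub>R x) * q * exp (- (t *\<^sub>R x)) - q) = norm ((exp (t *\<^sub>R ln1p y) - 1) * ?s) / 2"
    unfolding exp_conjugate_idempotent[OF tx] by simp
  also have "\<dots> \<le> norm (y * ?s) / 2"
    using norm_exp_ln1p_minus_one_le[OF y t, of ?s] by simp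
  also have "\<dots> = norm (p - q)"
    by (simp add: y_def reflection_product(1)[OF q])
  finally show "norm (exp (t *\<^sub>R x) * q * exp (- (t *\<^sub>R x)) - q) \<le> norm (p - q)" .
qed

subsection \<open>Operators\<close>

lemma idempotents_embed: "Q \<in> idempotents \<Longrightarrow> op_embed Q * op_embed Q = op_embed Q"
  by (simp add: idempotents_def flip: op_embed_simps(6))

lemma codiagonal_iff:
  assumes "Q \<in> idempotents"
  shows "X \<in> codiagonal Q \<longleftrightarrow> X \<in> bounded_ops \<and> X = (Q o\<^sub>L X) + (X o\<^sub>L Q)"
proof -
  have QQ: "Q (Q v) = Q v" for v
    using assms blinfun_apply_blinfun_compose[of Q Q v] by (simp add: idempotents_def)
  have "X = (Q o\<^sub>L X) + (X o\<^sub>L Q) \<longleftrightarrow>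
      Q o\<^sub>L X o\<^sub>L Q = 0 \<and> (id_blinfun - Q) o\<^sub>L X o\<^sub>L (id_blinfun - Q) = 0"
    (is "?L \<longleftrightarrow> ?C \<and> ?D")
  proof -
    have expand: "(id_blinfun - Q) o\<^sub>L X o\<^sub>L (id_blinfun - Q) = X - ((Q o\<^sub>L X) + (X o\<^sub>L Q)) + (Q o\<^sub>L X o\<^sub>L Q)"
      by (rule blinfun_eqI) (simp add: blinfun.bilinear_simps)
    have ?C if ?L
    proof (rule blinfun_eqI)
      fix v
      have "X (Q v) = Q (X (Q v)) + X (Q (Q v))"
        using arg_cong[OF that, of "\<lambda>T. T (Q v)"] by (simp add: blinfun.bilinear_simps)
      then show "(Q o\<^sub>L X o\<^sub>L Q) v = (0 :: 'a \<Rightarrow>\<^sub>L 'a) v" by (simp add: QQ)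
    qed
    then show ?thesis unfolding expand by auto
  qed
  then show ?thesis by (auto simp: codiagonal_def)
qed

lemma codiagonal_embed:
  assumes "Q \<in> idempotents" "X \<in> codiagonal Q"
  shows "op_embed X = op_embed Q * op_embed X + op_embed X * op_embed Q"
  using assms by (simp add: codiagonal_iff flip: op_embed_simps)

lemma codiagonal_scaleR:
  "X \<in> codiagonal Q \<Longrightarrow> t *\<^sub>R X \<in> codiagonal Q"
  by (auto simp: codiagonal_def bounded_ops_iff_commutes
      bounded_bilinear.scaleR_left[OF bounded_bilinear_blinfun_compose]
      bounded_bilinear.scaleR_right[OF bounded_bilinear_blinfun_compose])

lemma commuting_op_part_in_bounded_ops:
  assumes "\<And>c. op_embed (scaleC_op c) * x = x * op_embed (scaleC_op c)"
  shows "op_part x \<in> bounded_ops"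
  unfolding bounded_ops_iff_commutes using assms by (metis op_part_simps(7,8))

lemma op_embed_commutes:
  "X \<in> bounded_ops \<Longrightarrow> op_embed (scaleC_op c) * op_embed X = op_embed X * op_embed (scaleC_op c)"
  by (simp add: bounded_ops_iff_commutes flip: op_embed_simps(6))

lemma op_exp_eq: "op_exp X = op_part (exp (op_embed X))"
  for X :: "'a::banach \<Rightarrow>\<^sub>L 'a"
  using op_exp_op_part[of "op_embed X"] by simp

lemma exp_conj_eq: "exp_conj X Q = op_part (exp (op_embed X) * op_embed Q * exp (- op_embed X))"
  for X :: "'a::banach \<Rightarrow>\<^sub>L 'a"
  using exp_conj_op_part[of "op_embed X" "op_embed Q"] by simp

lemma op_exp_in_bounded_ops:
  assumes "X \<in> bounded_ops"
  shows "op_exp X \<in> bounded_ops"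
  unfolding op_exp_eq
  by (intro commuting_op_part_in_bounded_ops exp_intertwines op_embed_commutes assms)

lemma exp_conj_idempotents:
  assumes X: "X \<in> bounded_ops" and Q: "Q \<in> idempotents"
  shows "exp_conj X Q \<in> idempotents"
proof -
  let ?x = "op_embed X" and ?q = "op_embed Q"
  have "exp_conj X Q o\<^sub>L exp_conj X Q =
      op_part (exp ?x * ?q * (exp (- ?x) * exp ?x) * ?q * exp (- ?x))"
    unfolding exp_conj_eq op_part_simps(7)[symmetric] by (simp only: mult.assoc)
  also have "\<dots> = op_part (exp ?x * (?q * ?q) * exp (- ?x))"
    by (simp only: exp_minus_inverse' mult_1_right mult.assoc)
  also have "\<dots> = exp_conj X Q"
    by (simp only: idempotents_embed[OF Q] exp_conj_eq)
  finally have "exp_conj X Q o\<^sub>L exp_conj X Q = exp_conj X Q" .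
  moreover have "- X \<in> bounded_ops"
    using X by (simp add: bounded_ops_iff_commutes bounded_bilinear.minus_left[OF bounded_bilinear_blinfun_compose]
      bounded_bilinear.minus_right[OF bounded_bilinear_blinfun_compose])
  then have "exp_conj X Q \<in> bounded_ops"
    using op_exp_in_bounded_ops[of "- X"] op_exp_in_bounded_ops[OF X] Q
    by (simp add: exp_conj_def bounded_ops_def idempotents_def)
  ultimately show ?thesis by (simp add: idempotents_def)
qed

lemma exp_conj_zero [simp]: "exp_conj 0 Q = Q"
  for Q :: "'a::banach \<Rightarrow>\<^sub>L 'a"
  by (simp add: exp_conj_eq op_embed_simps)

text \<open>
  Through this identity the bound on \<open>e\<^bsup>2X\<^esup> - 1\<close> in the definition of the radius
  makes the logarithm of the product of the two symmetries available.
\<close>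
lemma reflection_product_eq_op_exp:
  assumes Q: "Q \<in> idempotents" and X: "X \<in> codiagonal Q" and R: "exp_conj X Q = R"
  shows "(R + R - id_blinfun) o\<^sub>L (Q + Q - id_blinfun) = op_exp (2 *\<^sub>R X)"
proof -
  let ?x = "op_embed X" and ?q = "op_embed Q"
  define p where "p = exp ?x * ?q * exp (- ?x)"
  have Rp: "R = op_part p" using R by (simp add: p_def exp_conj_eq)
  have qq: "?q * ?q = ?q" by (rule idempotents_embed[OF Q])
  have "2 *\<^sub>R (p - ?q) = (exp (2 *\<^sub>R ?x) - 1) * (?q + ?q - 1)"
    unfolding p_def exp_conjugate_idempotent[OF codiagonal_embed[OF Q X]] by simp
  then have "(p + p - 1) * (?q + ?q - 1) - 1 = (exp (2 *\<^sub>R ?x) - 1) * ((?q + ?q - 1) * (?q + ?q - 1))"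
    unfolding reflection_product(2)[OF qq, symmetric] by (simp only: mult.assoc)
  then have "(p + p - 1) * (?q + ?q - 1) = exp (2 *\<^sub>R ?x)"
    unfolding reflection_square[OF qq] mult_1_right by (metis diff_add_cancel)
  from arg_cong[OF this, of op_part] show ?thesis
    by (simp add: Rp op_exp_eq op_embed_simps)
qed

subsection \<open>The form defined by \<open>A\<close>\<close>

lemma adjoint_pair_wrt_op_part_power:
  assumes "adjoint_pair_wrt A (op_part x) (op_part x')"
  shows "adjoint_pair_wrt A (op_part (x ^ n)) (op_part (x' ^ n))"
proof (induction n)
  case (Suc n)
  have "x' ^ Suc n = x' ^ n * x'" by (rule power_Suc2)
  then show ?case
    using adjoint_pair_wrt_compose[OF assms Suc] by simp
qed (simp add: adjoint_pair_wrt_def)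

lemma adjoint_pair_wrt_functionals:
  fixes A :: "'a::real_inner \<Rightarrow>\<^sub>L 'a"
  shows "bounded_linear (\<lambda>z. inner (op_part z u) (A v))"
    "bounded_linear (\<lambda>z. inner u (A (op_part z v)))"
  by (intro bounded_linear_compose[OF bounded_linear_inner_left]
      bounded_linear_compose[OF bounded_linear_inner_right]
      bounded_linear_compose[OF blinfun.bounded_linear_right]
      bounded_linear_compose[OF blinfun.bounded_linear_left] bounded_linear_op_part)+

lemma adjoint_pair_wrt_op_exp:
  fixes X :: "'a::complex_hilbert \<Rightarrow>\<^sub>L 'a"
  assumes "adjoint_pair_wrt A X X'"
  shows "adjoint_pair_wrt A (op_exp X) (op_exp X')"
proof -
  have "adjoint_pair_wrt A (op_part (op_embed X ^ n)) (op_part (op_embed X' ^ n))" for n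
    by (rule adjoint_pair_wrt_op_part_power) (simp add: assms)
  then show ?thesis
    unfolding adjoint_pair_wrt_def op_exp_eq
    by (intro allI exp_transfer[OF adjoint_pair_wrt_functionals]) blast
qed

text \<open>If \<open>X\<close> is skew for the form, its exponential is unitary for it.\<close>
lemma adjoint_pair_wrt_exp_conj:
  fixes X :: "'a::complex_hilbert \<Rightarrow>\<^sub>L 'a"
  assumes X: "adjoint_pair_wrt A X (- X)" and Q: "adjoint_pair_wrt A Q Q"
  shows "adjoint_pair_wrt A (exp_conj X Q) (exp_conj X Q)"
proof -
  have "adjoint_pair_wrt A (- X) X"
    using X by (simp add: adjoint_pair_wrt_def blinfun.bilinear_simps)
  note E = adjoint_pair_wrt_op_exp[OF X] adjoint_pair_wrt_op_exp[OF this]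
  show ?thesis
    using adjoint_pair_wrt_compose[OF adjoint_pair_wrt_compose[OF E(1) Q] E(2)]
    by (simp add: exp_conj_def adjoint_pair_wrt_def)
qed

lemma adjoint_pair_wrt_reflection:
  "adjoint_pair_wrt A Q Q \<Longrightarrow>
    adjoint_pair_wrt A (Q + Q - id_blinfun) (Q + Q - id_blinfun)"
  by (simp add: adjoint_pair_wrt_def blinfun.bilinear_simps inner_add inner_diff)

text \<open>
  The exponent is constructed independently of \<open>A\<close>, so that it is skew for every form
  for which both idempotents are self-adjoint.
\<close>
lemma short_geodesic_exponent:
  fixes P Q :: "'a::complex_hilbert \<Rightarrow>\<^sub>L 'a"
  assumes P: "P \<in> idempotents" and Q: "Q \<in> idempotents"
    and small: "norm (((P + P - id_blinfun) o\<^sub>L (Q + Q - id_blinfun)) - id_blinfun) < 1"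
  obtains X where "X \<in> codiagonal Q" "exp_conj X Q = P"
    "\<And>t. t \<in> {0..1} \<Longrightarrow> norm (exp_conj (t *\<^sub>R X) Q - Q) \<le> norm (P - Q)"
    "\<And>A. adjoint_pair_wrt A P P \<Longrightarrow> adjoint_pair_wrt A Q Q \<Longrightarrow> adjoint_pair_wrt A X (- X)"
proof -
  define p q where "p = op_embed P" and "q = op_embed Q"
  have pp: "p * p = p" and qq: "q * q = q"
    using P Q by (simp_all add: p_def q_def idempotents_embed)
  define y where "y = (p + p - 1) * (q + q - 1) - 1"
  \<comment> \<open>The scalar component of \<open>y\<close> is \<open>(0 + 0 - 1)\<^sup>2 - 1 = 0\<close>,
    so its norm is that of the operator.\<close>
  have yY: "y = op_embed (((P + P - id_blinfun) o\<^sub>L (Q + Q - id_blinfun)) - id_blinfun)"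
    by (simp add: op_algebra_eq_iff y_def p_def q_def) (simp add: op_algebra_defs op_embed_def)
  have y: "norm y < 1" unfolding yY op_embed_simps(7) by (rule small)
  define x where "x = (1/2) *\<^sub>R ln1p y"
  note log = half_log_of_reflection_product[OF qq pp, folded y_def, folded x_def, OF y]
  let ?X = "op_part x"
  have conj: "exp_conj (t *\<^sub>R ?X) Q = op_part (exp (t *\<^sub>R x) * q * exp (- (t *\<^sub>R x)))" for t
    using exp_conj_op_part[of "t *\<^sub>R x" q] by (simp add: q_def)
  have "op_part x \<in> bounded_ops"
  proof (rule commuting_op_part_in_bounded_ops)
    fix c
    let ?c = "op_embed (scaleC_op c)"
    have "?c * p = p * ?c" "?c * q = q * ?c"
      using P Q by (simp_all add: p_def q_def op_embed_commutes idempotents_def)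
    then have "?c * (p + p - 1) = (p + p - 1) * ?c" "?c * (q + q - 1) = (q + q - 1) * ?c"
      by (simp_all add: algebra_simps)
    then have "?c * y = y * ?c"
      unfolding y_def by (simp add: left_diff_distrib right_diff_distrib) (metis mult.assoc)
    from ln1p_commutes[OF y this] show "?c * x = x * ?c" by (simp add: x_def)
  qed
  moreover have "?X = (Q o\<^sub>L ?X) + (?X o\<^sub>L Q)"
    using arg_cong[OF log(2), of op_part] by (simp add: q_def)
  ultimately have "?X \<in> codiagonal Q" by (simp add: codiagonal_iff Q)
  moreover have "exp_conj ?X Q = P"
    using conj[of 1] by (simp add: log(3) p_def)
  moreover have "norm (exp_conj (t *\<^sub>R ?X) Q - Q) \<le> norm (P - Q)" if "t \<in> {0..1}" for t
  proof -
    have "exp_conj (t *\<^sub>R ?X) Q - Q = op_part (exp (t *\<^sub>R x) * q * exp (- (t *\<^sub>R x)) - q)"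
      by (simp add: conj q_def)
    then have "norm (exp_conj (t *\<^sub>R ?X) Q - Q) \<le> norm (p - q)"
      using order_trans[OF norm_op_part_le log(4)[OF that]] by simp
    then show ?thesis by (simp add: p_def q_def flip: op_embed_simps)
  qed
  moreover have "adjoint_pair_wrt A ?X (- ?X)"
    if AP: "adjoint_pair_wrt A P P" and AQ: "adjoint_pair_wrt A Q Q" for A
  proof -
    let ?s = "q + q - 1"
    have ss: "?s * ?s = 1" by (rule reflection_square[OF qq])
    have sPs: "?s * ((p + p - 1) * ?s) * ?s = ?s * (p + p - 1)"
      by (simp only: mult.assoc ss mult_1_right)
    have "adjoint_pair_wrt A (op_part ((p + p - 1) * ?s)) (op_part (?s * (p + p - 1)))"
      using adjoint_pair_wrt_compose[OF adjoint_pair_wrt_reflection[OF AP] adjoint_pair_wrt_reflection[OF AQ]]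
      by (simp add: p_def q_def)
    moreover have "?s * y * ?s = ?s * (p + p - 1) - 1"
    proof -
      have "s * (w - 1) * s = s * w * s - s * s" for s w :: "'a op_algebra"
        by (simp add: algebra_simps)
      then show ?thesis by (simp only: y_def sPs ss)
    qed
    ultimately have "adjoint_pair_wrt A (op_part y) (op_part (?s * y * ?s))"
      by (simp add: y_def adjoint_pair_wrt_def blinfun.bilinear_simps inner_diff del: op_part_simps(7))
    moreover have pow: "(?s * y * ?s) ^ n = ?s * y ^ n * ?s" for n
    proof (induction n)
      case (Suc n)
      have "(?s * y * ?s) ^ Suc n = (?s * y * ?s) * (?s * y ^ n * ?s)"
        by (simp only: power_Suc Suc)
      also have "\<dots> = ?s * y * (?s * ?s) * y ^ n * ?s"
        by (simp only: mult.assoc)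
      finally show ?case by (simp only: ss mult_1_right power_Suc mult.assoc)
    qed (simp only: ss power_0 mult_1_right)
    ultimately have pair: "adjoint_pair_wrt A (op_part (y ^ n)) (op_part (?s * y ^ n * ?s))" for n
      using adjoint_pair_wrt_op_part_power by metis
    have "inner (op_part (ln1p y) u) (A v) = inner u (A (op_part (?s * ln1p y * ?s) v))" for u v
    proof (rule ln1p_transfer[OF y])
      show "bounded_linear (\<lambda>z. inner u (A (op_part (?s * z * ?s) v)))"
        by (rule bounded_linear_compose[OF adjoint_pair_wrt_functionals(2)],
            rule bounded_linear_compose[OF bounded_linear_mult_left bounded_linear_mult_right])
      show "inner (op_part (y ^ Suc n) u) (A v) = inner u (A (op_part (?s * y ^ Suc n * ?s) v))" for n
        using pair[of "Suc n"] by (simp only: adjoint_pair_wrt_def)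
    qed (rule adjoint_pair_wrt_functionals)
    then show ?thesis
      unfolding log(1) by (simp add: adjoint_pair_wrt_def x_def blinfun.bilinear_simps)
  qed
  ultimately show ?thesis by (rule that)
qed

section \<open>Lifting short arcs through the exponential\<close>

text \<open>
  The lifting argument below needs \<open>\<xi>\<close> to be continuous. The terms of positive degree are dominated by a
  geometric series whose sum is \<open>O(\<parallel>h\<parallel>)\<close>.
\<close>
lemma analytic_map_at_imp_isCont:
  fixes f :: "'a::real_normed_vector \<Rightarrow> 'b::banach"
  assumes "analytic_map_at f x"
  shows "isCont f x"
proof -
  obtain \<rho> C K a where "\<rho> > 0" "C \<ge> 0" "K \<ge> 0"
    and lin: "\<And>n. bounded_n_linear n (C * K ^ n) (a n)"
    and sums: "\<And>h. norm h < \<rho> \<Longrightarrow> (\<lambda>n. a n (\<lambda>_. h)) sums f (x + h)"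
    using assms by (auto simp: analytic_map_at_def)
  have bound: "norm (a n (\<lambda>_. h)) \<le> C * (K * norm h) ^ n" for n h
  proof -
    have "norm (a n (\<lambda>_. h)) \<le> C * K ^ n * (\<Prod>i<n. norm h)"
      using lin[of n] unfolding bounded_n_linear_def by blast
    then show ?thesis by (simp add: power_mult_distrib mult.assoc)
  qed
  have a0: "a 0 (\<lambda>_. h) = f x" for h
  proof -
    have "a n (\<lambda>_. 0) = 0" if "n \<noteq> 0" for n
      using bound[of n 0] that by (simp add: power_0_left)
    then have "(\<lambda>n. a n (\<lambda>_. 0)) sums a 0 (\<lambda>_. 0)"
      using sums_finite[of "{0}" "\<lambda>n. a n (\<lambda>_. 0)"] by simp
    then have "a 0 (\<lambda>_. 0) = f x"
      using sums_unique2 sums[of 0] \<open>\<rho> > 0\<close> by fastforce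
    moreover have "a 0 (\<lambda>_. h) = a 0 (\<lambda>_. 0)"
      using lin[of 0] by (auto simp: bounded_n_linear_def)
    ultimately show ?thesis by simp
  qed
  have main: "norm (f (x + h) - f x) \<le> 2 * C * K * norm h" if h: "norm h < \<rho>" "K * norm h \<le> 1/2" for h
  proof -
    let ?k = "K * norm h"
    have k: "0 \<le> ?k" using \<open>K \<ge> 0\<close> by simp
    have tail: "(\<lambda>n. a (Suc n) (\<lambda>_. h)) sums (f (x + h) - f x)"
      using sums[OF h(1)] by (subst sums_Suc_iff) (simp add: a0)
    have geo: "(\<lambda>n. C * ?k * ?k ^ n) sums (C * ?k * (1 / (1 - ?k)))"
      by (intro sums_mult geometric_sums) (use h k in simp)
    have "norm (f (x + h) - f x) \<le> C * ?k * (1 / (1 - ?k))"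
      unfolding sums_unique[OF tail] sums_unique[OF geo]
      by (rule norm_suminf_le[OF _ sums_summable[OF geo]]) (use bound[of "Suc _" h] in \<open>simp add: mult.assoc\<close>)
    also have "\<dots> \<le> C * ?k * 2"
      using h k \<open>C \<ge> 0\<close> by (intro mult_left_mono) (auto simp: divide_le_eq)
    finally show ?thesis by (simp add: mult_ac)
  qed
  have "((\<lambda>h. f (x + h) - f x) \<longlongrightarrow> 0) (at 0)"
  proof (rule Lim_null_comparison)
    have "((\<lambda>h::'a. K * norm h) \<longlongrightarrow> K * norm (0::'a)) (at 0)" "((\<lambda>h::'a. norm h) \<longlongrightarrow> norm (0::'a)) (at 0)"
      by (rule tendsto_mult_left tendsto_norm[OF tendsto_ident_at])+
    note lim = this
    have "\<forall>\<^sub>F h::'a in at 0. K * norm h < 1/2" "\<forall>\<^sub>F h::'a in at 0. norm h < \<rho>"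
      by (rule order_tendstoD(2)[OF lim(1)] order_tendstoD(2)[OF lim(2)], simp add: \<open>\<rho> > 0\<close>)+
    then show "\<forall>\<^sub>F h in at 0. norm (f (x + h) - f x) \<le> 2 * C * K * norm h"
      by eventually_elim (simp add: main)
    show "((\<lambda>h::'a. 2 * C * K * norm h) \<longlongrightarrow> 0) (at 0)"
      by (auto intro!: tendsto_eq_intros)
  qed
  then show ?thesis
    unfolding isCont_iff by (simp add: LIM_zero_iff)
qed

lemma analytic_map_on_imp_continuous_on:
  fixes f :: "'a::real_normed_vector \<Rightarrow> 'b::banach"
  assumes "analytic_map_on S f"
  shows "continuous_on S f"
  unfolding continuous_on_eq_continuous_within
proof
  fix x assume x: "x \<in> S"
  obtain g e where g: "analytic_map_at g x" and "e > 0" and eq: "\<forall>y\<in>S. dist y x < e \<longrightarrow> f y = g y"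
    using bspec[OF assms[unfolded analytic_map_on_def] x] by blast
  have "continuous (at x within S) g"
    by (rule continuous_at_imp_continuous_within[OF analytic_map_at_imp_isCont[OF g]])
  then show "continuous (at x within S) f"
    by (rule continuous_transform_within[OF _ \<open>e > 0\<close> x]) (simp add: eq)
qed

lemma continuous_on_exp_conj_scaleR:
  fixes X :: "'a::banach \<Rightarrow>\<^sub>L 'a"
  shows "continuous_on S (\<lambda>t. exp_conj (t *\<^sub>R X) Q)"
proof -
  have c: "continuous_on S (\<lambda>t. exp (t *\<^sub>R x))" for x :: "'a op_algebra"
    unfolding continuous_on_eq_continuous_within
    by (intro ballI has_vector_derivative_continuous[OF exp_scaleR_has_vector_derivative_right])
  let ?x = "op_embed X"
  have eq: "exp_conj (t *\<^sub>R X) Q = op_part (exp (t *\<^sub>R ?x) * op_embed Q * exp (t *\<^sub>R (- ?x)))" for t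
    by (simp add: exp_conj_eq op_embed_simps)
  show ?thesis
    unfolding eq by (rule bounded_linear.continuous_on[OF bounded_linear_op_part
        continuous_on_mult[OF continuous_on_mult[OF c continuous_on_const] c]])
qed

lemma inverse_radius_unique:
  assumes "inverse_radius P r V" "P \<in> idempotents" "X \<in> V" "Y \<in> V"
    "exp_conj X P = R" "exp_conj Y P = R" "R \<in> idempotents" "norm (R - P) < r"
  shows "X = Y"
proof -
  have "\<exists>!X. X \<in> V \<and> exp_conj X P = R"
    using assms(1,7,8) unfolding inverse_radius_def by blast
  then show ?thesis using assms(3-6) by blast
qed

text \<open>
  The lifting argument: a multiple \<open>t Z\<close> belongs to \<open>V\<close> iff it equals
  \<open>\<xi>(e\<^bsup>tZ\<^esup> P e\<^bsup>-tZ\<^esup>)\<close>. The first condition is open in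
  \<open>t\<close>, the second one closed.
\<close>
lemma arc_in_ball_exponent_mem:
  assumes P: "P \<in> idempotents" and Z: "Z \<in> codiagonal P" and rad: "inverse_radius P r V"
    and arc: "\<And>t. t \<in> {0..1} \<Longrightarrow> norm (exp_conj (t *\<^sub>R Z) P - P) < r"
  shows "Z \<in> V"
proof -
  define B where "B = {R \<in> idempotents. norm (R - P) < r}"
  obtain \<xi> where V: "openin (top_of_set (codiagonal P)) V" "0 \<in> V"
    and \<xi>: "\<And>R. R \<in> B \<Longrightarrow> \<xi> R \<in> V \<and> exp_conj (\<xi> R) P = R" and an: "analytic_map_on B \<xi>"
    using rad unfolding inverse_radius_def B_def by blast
  let ?c = "\<lambda>t. exp_conj (t *\<^sub>R Z) P"
  have tZ: "t *\<^sub>R Z \<in> codiagonal P" for t by (rule codiagonal_scaleR[OF Z])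
  have cB: "?c t \<in> B" if "t \<in> {0..1}" for t
    using arc[OF that] exp_conj_idempotents[OF _ P] tZ by (simp add: B_def codiagonal_def)
  define T where "T = {t \<in> {0..1}. t *\<^sub>R Z \<in> V}"
  have "openin (top_of_set {0..1}) ({0..1} \<inter> (\<lambda>t. t *\<^sub>R Z) -` V)"
    by (rule continuous_openin_preimage[OF _ _ V(1)]) (auto intro!: continuous_intros simp: tZ)
  moreover have "{0..1} \<inter> (\<lambda>t. t *\<^sub>R Z) -` V = T" by (auto simp: T_def)
  ultimately have "openin (top_of_set {0..1}) T" by simp
  moreover have "closedin (top_of_set {0..1}) T"
  proof -
    have "continuous_on {0..1} (\<lambda>t. \<xi> (?c t))"
      using continuous_on_compose2[OF analytic_map_on_imp_continuous_on[OF an]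
          continuous_on_exp_conj_scaleR] cB by blast
    then have "continuous_on {0..1} (\<lambda>t. \<xi> (?c t) - t *\<^sub>R Z)"
      by (intro continuous_intros)
    then have "closedin (top_of_set {0..1}) {t \<in> {0..1}. \<xi> (?c t) - t *\<^sub>R Z = 0}"
      by (rule continuous_closedin_preimage_constant)
    moreover have "\<xi> (?c t) = t *\<^sub>R Z \<longleftrightarrow> t *\<^sub>R Z \<in> V" if t: "t \<in> {0..1}" for t
      using \<xi>[OF cB[OF t]] cB[OF t] inverse_radius_unique[OF rad P, of "\<xi> (?c t)" "t *\<^sub>R Z" "?c t"]
      by (auto simp: B_def)
    then have "{t \<in> {0..1}. \<xi> (?c t) - t *\<^sub>R Z = 0} = T" by (auto simp: T_def)
    ultimately show ?thesis by simp
  qed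
  moreover have "connected {0..1::real}" by simp
  ultimately have "T = {} \<or> T = {0..1}" by (simp add: connected_clopen)
  moreover have "0 \<in> T" using V(2) by (simp add: T_def)
  ultimately have "1 \<in> T" by auto
  then show ?thesis by (simp add: T_def)
qed

text \<open>
  A geodesic can be based at any of its points with the same exponent, because
  \<open>e\<^bsup>aZ\<^esup>\<close> commutes with \<open>Z\<close> and so preserves the co-diagonality
  relation.
\<close>
lemma geodesic_based_at:
  assumes "geodesic \<gamma>"
  obtains Z where "Z \<in> codiagonal (\<gamma> a)" "\<And>t. \<gamma> t = exp_conj ((t - a) *\<^sub>R Z) (\<gamma> a)"
proof -
  obtain P Z where P: "P \<in> idempotents" and Z: "Z \<in> codiagonal P"
    and \<gamma>: "\<And>t. \<gamma> t = exp_conj (t *\<^sub>R Z) P"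
    using assms by (auto simp: geodesic_def)
  define z q where "z = op_embed Z" and "q = op_embed P"
  have \<gamma>': "\<gamma> t = op_part (exp (t *\<^sub>R z) * q * exp (- (t *\<^sub>R z)))" for t
    by (simp add: \<gamma> exp_conj_eq z_def q_def op_embed_simps)
  let ?e = "exp (a *\<^sub>R z)" and ?e' = "exp (- (a *\<^sub>R z))"
  have Zb: "Z \<in> bounded_ops" using Z by (simp add: codiagonal_def)
  have zq: "z = q * z + z * q"
    unfolding z_def q_def by (rule codiagonal_embed[OF P Z])
  have ze: "z * ?e = ?e * z" "z * ?e' = ?e' * z"
    by (rule exp_intertwines, simp)+
  have "z = z * (?e * ?e')" by (simp only: exp_minus_inverse mult_1_right)
  also have "\<dots> = ?e * z * ?e'" by (simp only: ze(1) mult.assoc[symmetric])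
  also have "\<dots> = ?e * (q * z + z * q) * ?e'" by (simp only: zq[symmetric])
  also have "\<dots> = (?e * q * ?e') * z + z * (?e * q * ?e')"
  proof -
    have "?e * (q * z + z * q) * ?e' = ?e * q * (z * ?e') + (?e * z) * q * ?e'"
      by (simp only: distrib_left distrib_right mult.assoc)
    also have "\<dots> = ?e * q * (?e' * z) + (z * ?e) * q * ?e'" by (simp only: ze)
    also have "\<dots> = (?e * q * ?e') * z + z * (?e * q * ?e')" by (simp only: mult.assoc)
    finally show ?thesis .
  qed
  finally have "op_part z = op_part ((?e * q * ?e') * z + z * (?e * q * ?e'))"
    by (rule arg_cong)
  moreover have "op_part z = Z" by (simp add: z_def)
  ultimately have "Z = (\<gamma> a o\<^sub>L Z) + (Z o\<^sub>L \<gamma> a)"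
    by (simp only: \<gamma>' op_part_simps)
  moreover have idem: "\<gamma> a \<in> idempotents"
    unfolding \<gamma> using codiagonal_scaleR[OF Z] P by (intro exp_conj_idempotents) (auto simp: codiagonal_def)
  ultimately have "Z \<in> codiagonal (\<gamma> a)" using Zb codiagonal_iff[OF idem, of Z] by blast
  moreover have "\<gamma> t = exp_conj ((t - a) *\<^sub>R Z) (\<gamma> a)" for t
  proof -
    have "exp (t *\<^sub>R z) = exp ((t - a) *\<^sub>R z) * ?e" "exp (- (t *\<^sub>R z)) = ?e' * exp (- ((t - a) *\<^sub>R z))"
      using exp_add_commuting[of "(t - a) *\<^sub>R z" "a *\<^sub>R z"]
        exp_add_commuting[of "- (a *\<^sub>R z)" "- ((t - a) *\<^sub>R z)"]
      by (simp_all add: algebra_simps)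
    then have "\<gamma> t = op_part (exp ((t - a) *\<^sub>R z) * (?e * q * ?e') * exp (- ((t - a) *\<^sub>R z)))"
      unfolding \<gamma>' by (simp only: mult.assoc)
    then show ?thesis
      using exp_conj_op_part[of "(t - a) *\<^sub>R z" "?e * q * ?e'"]
      unfolding \<gamma>'[of a] by (simp add: z_def)
  qed
  ultimately show ?thesis by (rule that)
qed

theorem corollary4p7:
  fixes A Q Q\<^sub>0 :: "'a::complex_hilbert \<Rightarrow>\<^sub>L 'a"
    and r :: real and V :: "('a \<Rightarrow>\<^sub>L 'a) set"
  assumes "positive_op A"
    and "\<forall>x. blinfun_apply A x = 0 \<longrightarrow> x = 0"
    and "positive_op (id_blinfun - A)"
    and "Q \<in> compatible_Gr A" and "Q\<^sub>0 \<in> compatible_Gr A"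
    and "inverse_radius Q\<^sub>0 r V"
    and "norm (Q - Q\<^sub>0) < r"
  shows "\<exists>\<delta>. geodesic \<delta> \<and> joins \<delta> 0 1 Q\<^sub>0 Q \<and>
      exponent_in V \<delta> 0 1 \<and> arc_in_ball r \<delta> 0 1 \<and>
      (\<forall>\<gamma> a b. geodesic \<gamma> \<and> joins \<gamma> a b Q\<^sub>0 Q \<and>
          (exponent_in V \<gamma> a b \<or> arc_in_ball r \<gamma> a b) \<longrightarrow> reparametrization_of \<gamma> \<delta>) \<and>
      (\<forall>t. \<delta> t \<in> compatible_Gr A)"
proof -
  note rad = assms(6)
  have Q: "Q \<in> idempotents" "adjoint_pair_wrt A Q Q" and Q0: "Q\<^sub>0 \<in> idempotents" "adjoint_pair_wrt A Q\<^sub>0 Q\<^sub>0"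
    using assms(4,5) by (simp_all add: compatible_Gr_iff)
  have "norm (((Q + Q - id_blinfun) o\<^sub>L (Q\<^sub>0 + Q\<^sub>0 - id_blinfun)) - id_blinfun) < 1"
  proof -
    obtain Y where "Y \<in> V" "exp_conj Y Q\<^sub>0 = Q" "norm (op_exp (2 *\<^sub>R Y) - id_blinfun) < 1"
      using rad Q(1) assms(7) unfolding inverse_radius_def by blast
    moreover have "V \<subseteq> codiagonal Q\<^sub>0"
      using rad openin_imp_subset unfolding inverse_radius_def by blast
    ultimately show ?thesis
      using reflection_product_eq_op_exp[OF Q0(1), of Y Q] by auto
  qed
  from short_geodesic_exponent[OF Q(1) Q0(1) this] obtain X where X: "X \<in> codiagonal Q\<^sub>0"
    and end1: "exp_conj X Q\<^sub>0 = Q"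
    and short: "\<And>t. t \<in> {0..1} \<Longrightarrow> norm (exp_conj (t *\<^sub>R X) Q\<^sub>0 - Q\<^sub>0) \<le> norm (Q - Q\<^sub>0)"
    and XA: "adjoint_pair_wrt A X (- X)"
    using Q(2) Q0(2) by metis
  have arc: "norm (exp_conj (t *\<^sub>R X) Q\<^sub>0 - Q\<^sub>0) < r" if "t \<in> {0..1}" for t
    using short[OF that] assms(7) by simp
  have XV: "X \<in> V"
    by (rule arc_in_ball_exponent_mem[OF Q0(1) X rad arc])
  define \<delta> where "\<delta> = (\<lambda>t. exp_conj (t *\<^sub>R X) Q\<^sub>0)"
  have \<delta>01: "\<delta> 0 = Q\<^sub>0" "\<delta> 1 = Q" by (simp_all add: \<delta>_def end1)
  have "geodesic \<delta>" unfolding geodesic_def \<delta>_def using Q0(1) X by blast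
  moreover have "joins \<delta> 0 1 Q\<^sub>0 Q" by (simp add: joins_def \<delta>01)
  moreover have "exponent_in V \<delta> 0 1"
    unfolding exponent_in_def \<delta>01 using X XV by (auto simp: \<delta>_def)
  moreover have "arc_in_ball r \<delta> 0 1"
    unfolding arc_in_ball_def \<delta>01 using arc by (simp add: \<delta>_def closed_segment_eq_real_ivl)
  moreover have "reparametrization_of \<gamma> \<delta>"
    if \<gamma>: "geodesic \<gamma>" "joins \<gamma> a b Q\<^sub>0 Q" and alt: "exponent_in V \<gamma> a b \<or> arc_in_ball r \<gamma> a b" for \<gamma> a b
  proof -
    have ab: "a \<noteq> b" "\<gamma> a = Q\<^sub>0" "\<gamma> b = Q" using \<gamma>(2) by (auto simp: joins_def)
    obtain Z where \<gamma>Z: "\<And>t. \<gamma> t = exp_conj ((t - a) *\<^sub>R Z) Q\<^sub>0" and ZV: "(b - a) *\<^sub>R Z \<in> V"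
    proof (cases "exponent_in V \<gamma> a b")
      case True
      then show ?thesis using that ab(2) by (auto simp: exponent_in_def)
    next
      case False
      with alt have ball: "arc_in_ball r \<gamma> a b" by simp
      obtain Z where Z: "Z \<in> codiagonal Q\<^sub>0" "\<And>t. \<gamma> t = exp_conj ((t - a) *\<^sub>R Z) Q\<^sub>0"
        using geodesic_based_at[OF \<gamma>(1), of a] ab(2) by metis
      have "(b - a) *\<^sub>R Z \<in> V"
      proof (rule arc_in_ball_exponent_mem[OF Q0(1) codiagonal_scaleR[OF Z(1)] rad])
        fix t :: real assume t: "t \<in> {0..1}"
        have "a + t * (b - a) \<in> closed_segment a b"
          using t by (auto simp: closed_segment_def algebra_simps intro!: exI[of _ t])
        then have "norm (\<gamma> (a + t * (b - a)) - Q\<^sub>0) < r"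
          using ball ab(2) by (simp add: arc_in_ball_def)
        then show "norm (exp_conj (t *\<^sub>R (b - a) *\<^sub>R Z) Q\<^sub>0 - Q\<^sub>0) < r" by (simp add: Z(2))
      qed
      then show ?thesis using that Z(2) by blast
    qed
    have XZ: "(b - a) *\<^sub>R Z = X"
      by (rule inverse_radius_unique[OF rad Q0(1) ZV XV _ end1 Q(1) assms(7)])
        (use \<gamma>Z[of b] ab(3) in simp)
    have "(1 / (b - a) * t + - a / (b - a)) * (b - a) = t - a" for t
    proof -
      have "1 / (b - a) * t + - a / (b - a) = (t - a) / (b - a)"
        by (simp add: diff_divide_distrib)
      then show ?thesis using ab(1) by simp
    qed
    then have "\<gamma> t = \<delta> (1 / (b - a) * t + - a / (b - a))" for t
      unfolding \<gamma>Z \<delta>_def XZ[symmetric] scaleR_scaleR by simp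
    then show ?thesis
      unfolding reparametrization_of_def using ab(1) by (intro exI[of _ "1 / (b - a)"] exI[of _ "- a / (b - a)"]) simp
  qed
  moreover have "\<delta> t \<in> compatible_Gr A" for t
  proof -
    have "adjoint_pair_wrt A (t *\<^sub>R X) (- (t *\<^sub>R X))"
      using XA by (simp add: adjoint_pair_wrt_def blinfun.bilinear_simps)
    moreover have "t *\<^sub>R X \<in> bounded_ops"
      using codiagonal_scaleR[OF X] by (simp add: codiagonal_def)
    ultimately show ?thesis
      unfolding compatible_Gr_iff \<delta>_def using Q0
      by (simp add: exp_conj_idempotents adjoint_pair_wrt_exp_conj)
  qed
  ultimately show ?thesis by blast
qed

end
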